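(* Let $\mathbf{k}$ be a field of characteristic zero, $n\ge4$, and $S=(a_1,\dots,a_n)$ with positive integer entries such that $\mathrm{cotype}(S)=0$. Let $B_S=\mathbf{k}[X_1,\dots,X_n]/\langle X_1^{a_1}+\cdots+X_n^{a_n}\rangle$ with its standard $\mathbb{N}$-grading. Then: (a) $\mathbb{Z}(\ker D)=\mathbb{Z}$ for all $D\in\mathrm{HLND}(B_S)$. (b) If $B_S$ is not rigid, then the projective $\mathbf{k}$-variety $\mathrm{Proj}\,B_S$ is ruled over $\mathbf{k}$ (i.e. its function field is ruled over $\mathbf{k}$).
   Context: Write $x_i$ for the image of $X_i$ in $B_S$ and $L=\mathrm{lcm}(S)$; the standard $\mathbb{N}$-grading of $B_S$ is the unique one in which $x_i$ is homogeneous of degree $L/a_i$. $\mathrm{cotype}(S)$ is the number of indices $i$ with $a_i\nmid\mathrm{lcm}(a_1,\dots,\widehat{a_i},\dots,a_n)$. A derivation is locally nilpotent if every element is killed by some power of it, and homogeneous if it shifts degrees by a fixed amount; $\mathrm{HLND}(B_S)$ is the set of homogeneous locally nilpotent derivations. For a graded subring $A$, $\mathbb{Z}(A)$ is the subgroup of $\mathbb{Z}$ generated by the degrees $i$ with $A\cap (B_S)_i\neq 0$. $B_S$ is rigid if its only locally nilpotent derivation is $0$. A field extension $L/\mathbf{k}$ is ruled if $L=K^{(1)}$ (purely transcendental of transcendence degree 1) for some field $K$ with $\mathbf{k}\subseteq K\subseteq L$; a variety is ruled if its function field is ruled over $\mathbf{k}$. *)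

theory Defs
  imports "HOL-Library.Poly_Mapping" "HOL-Algebra.Algebra"
begin

text \<open>Polynomials over a field 'k in the variables indexed by the finite type 'v
  (so n = CARD('v)), represented as finitely supported maps from monomials
  (exponent vectors) to coefficients.\<close>

type_synonym ('v, 'k) mpoly = "('v \<Rightarrow>\<^sub>0 nat) \<Rightarrow>\<^sub>0 'k"

definition Xvar :: "'v \<Rightarrow> ('v, 'k::comm_ring_1) mpoly" where
  "Xvar i = Poly_Mapping.single (Poly_Mapping.single i 1) 1"

definition Cst :: "'k::comm_ring_1 \<Rightarrow> ('v, 'k) mpoly" where
  "Cst c = Poly_Mapping.single 0 c"

definition fermat :: "('v::finite \<Rightarrow> nat) \<Rightarrow> ('v, 'k::comm_ring_1) mpoly" where
  "fermat a = (\<Sum>i\<in>UNIV. Xvar i ^ a i)"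

definition cotype :: "('v::finite \<Rightarrow> nat) \<Rightarrow> nat" where
  "cotype a = card {i. \<not> a i dvd Lcm (a ` (UNIV - {i}))}"

definition bcls :: "('v::finite \<Rightarrow> nat) \<Rightarrow> ('v, 'k::comm_ring_1) mpoly \<Rightarrow> ('v, 'k) mpoly set" where
  "bcls a p = {q. \<exists>g. q = p + fermat a * g}"

definition brep :: "('v, 'k) mpoly set \<Rightarrow> ('v, 'k) mpoly" where
  "brep A = (SOME p. p \<in> A)"

definition BS :: "('v::finite \<Rightarrow> nat) \<Rightarrow> (('v, 'k::comm_ring_1) mpoly set) ring" where
  "BS a = \<lparr> carrier = range (bcls a),
            monoid.mult = (\<lambda>A B. bcls a (brep A * brep B)),
            monoid.one = bcls a 1,
            ring.zero = bcls a 0,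
            ring.add = (\<lambda>A B. bcls a (brep A + brep B)) \<rparr>"

definition bscal :: "('v::finite \<Rightarrow> nat) \<Rightarrow> 'k::comm_ring_1 \<Rightarrow> ('v, 'k) mpoly set" where
  "bscal a c = bcls a (Cst c)"

definition lcmS :: "('v::finite \<Rightarrow> nat) \<Rightarrow> nat" where
  "lcmS a = Lcm (range a)"

definition monodeg :: "('v::finite \<Rightarrow> nat) \<Rightarrow> ('v \<Rightarrow>\<^sub>0 nat) \<Rightarrow> nat" where
  "monodeg a m = (\<Sum>i\<in>UNIV. Poly_Mapping.lookup m i * (lcmS a div a i))"

definition homog :: "('v::finite \<Rightarrow> nat) \<Rightarrow> nat \<Rightarrow> ('v, 'k::zero) mpoly \<Rightarrow> bool" where
  "homog a d p \<longleftrightarrow> (\<forall>m\<in>Poly_Mapping.keys p. monodeg a m = d)"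

definition Bdeg :: "('v::finite \<Rightarrow> nat) \<Rightarrow> int \<Rightarrow> ('v, 'k::comm_ring_1) mpoly set set" where
  "Bdeg a d = {bcls a p | p. p = 0 \<or> (d \<ge> 0 \<and> homog a (nat d) p)}"

definition is_kder :: "('v::finite \<Rightarrow> nat) \<Rightarrow> (('v, 'k::comm_ring_1) mpoly set \<Rightarrow> ('v, 'k) mpoly set) \<Rightarrow> bool" where
  "is_kder a D \<longleftrightarrow>
     D \<in> carrier (BS a) \<rightarrow> carrier (BS a) \<and>
     (\<forall>x\<in>carrier (BS a). \<forall>y\<in>carrier (BS a).
        D (x \<oplus>\<^bsub>BS a\<^esub> y) = D x \<oplus>\<^bsub>BS a\<^esub> D y \<and>
        D (x \<otimes>\<^bsub>BS a\<^esub> y) = (x \<otimes>\<^bsub>BS a\<^esub> D y) \<oplus>\<^bsub>BS a\<^esub> (D x \<otimes>\<^bsub>BS a\<^esub> y)) \<and>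
     (\<forall>c. \<forall>x\<in>carrier (BS a). D (bscal a c \<otimes>\<^bsub>BS a\<^esub> x) = bscal a c \<otimes>\<^bsub>BS a\<^esub> D x)"

definition is_LND :: "('v::finite \<Rightarrow> nat) \<Rightarrow> (('v, 'k::comm_ring_1) mpoly set \<Rightarrow> ('v, 'k) mpoly set) \<Rightarrow> bool" where
  "is_LND a D \<longleftrightarrow> is_kder a D \<and>
     (\<forall>x\<in>carrier (BS a). \<exists>m. (D ^^ m) x = \<zero>\<^bsub>BS a\<^esub>)"

definition is_homog_der :: "('v::finite \<Rightarrow> nat) \<Rightarrow> (('v, 'k::comm_ring_1) mpoly set \<Rightarrow> ('v, 'k) mpoly set) \<Rightarrow> bool" where
  "is_homog_der a D \<longleftrightarrow> (\<exists>e::int. \<forall>d. \<forall>x\<in>Bdeg a d. D x \<in> Bdeg a (d + e))"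

definition HLND :: "('v::finite \<Rightarrow> nat) \<Rightarrow> (('v, 'k::comm_ring_1) mpoly set \<Rightarrow> ('v, 'k) mpoly set) set" where
  "HLND a = {D. is_LND a D \<and> is_homog_der a D}"

definition derker :: "('v::finite \<Rightarrow> nat) \<Rightarrow> (('v, 'k::comm_ring_1) mpoly set \<Rightarrow> ('v, 'k) mpoly set) \<Rightarrow> ('v, 'k) mpoly set set" where
  "derker a D = {x\<in>carrier (BS a). D x = \<zero>\<^bsub>BS a\<^esub>}"

definition rigid :: "('v::finite \<Rightarrow> nat) \<Rightarrow> 'k::comm_ring_1 itself \<Rightarrow> bool" where
  "rigid a TYPE('k) \<longleftrightarrow>
     (\<forall>D :: ('v, 'k) mpoly set \<Rightarrow> ('v, 'k) mpoly set. is_LND a D \<longrightarrow>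
        (\<forall>x\<in>carrier (BS a). D x = \<zero>\<^bsub>BS a\<^esub>))"

inductive_set zspan :: "int set \<Rightarrow> int set" for G where
  zero: "0 \<in> zspan G"
| plus: "g \<in> G \<Longrightarrow> x \<in> zspan G \<Longrightarrow> x + g \<in> zspan G"
| minus: "g \<in> G \<Longrightarrow> x \<in> zspan G \<Longrightarrow> x - g \<in> zspan G"

definition Zgrp :: "('v::finite \<Rightarrow> nat) \<Rightarrow> ('v, 'k::comm_ring_1) mpoly set set \<Rightarrow> int set" where
  "Zgrp a A = zspan {i. \<exists>x\<in>A \<inter> Bdeg a i. x \<noteq> \<zero>\<^bsub>BS a\<^esub>}"

subsection \<open>Function field of Proj B_S: degree-zero homogeneous fractions\<close>

definition hpairs :: "('v::finite \<Rightarrow> nat) \<Rightarrow> (('v, 'k::comm_ring_1) mpoly set \<times> ('v, 'k) mpoly set) set" where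
  "hpairs a = {(f, g). \<exists>d. f \<in> Bdeg a d \<and> g \<in> Bdeg a d \<and> g \<noteq> \<zero>\<^bsub>BS a\<^esub>}"

definition fcls :: "('v::finite \<Rightarrow> nat) \<Rightarrow> ('v, 'k::comm_ring_1) mpoly set \<times> ('v, 'k) mpoly set
    \<Rightarrow> (('v, 'k) mpoly set \<times> ('v, 'k) mpoly set) set" where
  "fcls a fg = {(f', g') \<in> hpairs a.
      fst fg \<otimes>\<^bsub>BS a\<^esub> g' = f' \<otimes>\<^bsub>BS a\<^esub> snd fg}"

definition frep :: "('x \<times> 'x) set \<Rightarrow> 'x \<times> 'x" where
  "frep F = (SOME p. p \<in> F)"

definition FunField :: "('v::finite \<Rightarrow> nat) \<Rightarrow> ((('v, 'k::comm_ring_1) mpoly set \<times> ('v, 'k) mpoly set) set) ring" where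
  "FunField a = \<lparr> carrier = fcls a ` hpairs a,
     monoid.mult = (\<lambda>F G. fcls a (fst (frep F) \<otimes>\<^bsub>BS a\<^esub> fst (frep G), snd (frep F) \<otimes>\<^bsub>BS a\<^esub> snd (frep G))),
     monoid.one = fcls a (\<one>\<^bsub>BS a\<^esub>, \<one>\<^bsub>BS a\<^esub>),
     ring.zero = fcls a (\<zero>\<^bsub>BS a\<^esub>, \<one>\<^bsub>BS a\<^esub>),
     ring.add = (\<lambda>F G. fcls a ((fst (frep F) \<otimes>\<^bsub>BS a\<^esub> snd (frep G)) \<oplus>\<^bsub>BS a\<^esub> (fst (frep G) \<otimes>\<^bsub>BS a\<^esub> snd (frep F)),
                          snd (frep F) \<otimes>\<^bsub>BS a\<^esub> snd (frep G))) \<rparr>"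

definition kimage :: "('v::finite \<Rightarrow> nat) \<Rightarrow> 'k::comm_ring_1 itself \<Rightarrow> (('v, 'k) mpoly set \<times> ('v, 'k) mpoly set) set set" where
  "kimage a TYPE('k) = {fcls a (bscal a c, \<one>\<^bsub>BS a\<^esub>) | c :: 'k. True}"

definition ruled_ext :: "('a, 'b) ring_scheme \<Rightarrow> 'a set \<Rightarrow> bool" where
  "ruled_ext L k0 \<longleftrightarrow>
     (\<exists>K t. subfield K L \<and> k0 \<subseteq> K \<and> t \<in> carrier L \<and>
        ring.transcendental L K t \<and> carrier L = generate_field L (insert t K))"

definition Proj_ruled :: "('v::finite \<Rightarrow> nat) \<Rightarrow> 'k::comm_ring_1 itself \<Rightarrow> bool" where
  "Proj_ruled a TYPE('k) \<longleftrightarrow> ruled_ext (FunField a :: (('v, 'k) mpoly set \<times> ('v, 'k) mpoly set) set ring) (kimage a TYPE('k))"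

end

theory Submission
  imports Defs "HOL-Algebra.Algebraic_Closure_Type" "HOL-Computational_Algebra.Formal_Laurent_Series"
    "HOL-Computational_Algebra.Fraction_Field"
begin

text \<open>Let \<open>B\<close> be the Pham-Brieskorn ring, \<open>D \<noteq> 0\<close> a homogeneous locally nilpotent derivation, \<open>A = ker D\<close>, and
  \<open>s\<close> a homogeneous element with \<open>\<alpha> = D s \<noteq> 0\<close> and \<open>D \<alpha> = 0\<close>. Then \<open>B \<subseteq> A\<^sub>\<alpha>[s]\<close>, and setting \<open>s = 0\<close> is a graded
  homomorphism \<open>B \<rightarrow> A\<^sub>\<alpha>\<close>. If it killed two of the variables, \<open>\<alpha>\<^sup>N x\<^sub>i = s u\<close> and \<open>\<alpha>\<^sup>N x\<^sub>j = s v\<close>, then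
  \<open>x\<^sub>i v = x\<^sub>j u\<close>; as \<open>x\<^sub>i, x\<^sub>j\<close> is a regular sequence, \<open>x\<^sub>i\<close> divides \<open>u\<close>, so \<open>s\<close> divides \<open>\<alpha>\<^sup>N\<close>, which
  is impossible because \<open>A\<close> is factorially closed. So the degrees of all but one variable belong to the group
  generated by the degrees of \<open>A\<close>, and for cotype \<open>0\<close> these are coprime. For (b) one replaces a derivation
  by its leading homogeneous component; by (a) there is a homogeneous fraction \<open>\<theta>\<close> of \<open>A\<close> of degree
  \<open>- deg s\<close>, and the function field is \<open>K(s \<theta>)\<close> with \<open>K\<close> the field of fractions of degree \<open>0\<close> of \<open>A\<close>.

  That \<open>B\<close> is a domain is proved by embedding it in a field of Laurent series in \<open>u\<close>: the generic point of the
  divisor \<open>x\<^sub>j = 0\<close>, totally ramified over its projection along \<open>x\<^sub>j\<close>, provides a zero of the Fermat polynomial at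
  which no other polynomials vanish than its multiples.\<close>

section \<open>Evaluation of polynomials\<close>

lemma poly_mapping_sum_single:
  "p = (\<Sum>m\<in>Poly_Mapping.keys p. Poly_Mapping.single m (Poly_Mapping.lookup p m))"
  by (rule poly_mapping_eqI)
     (auto simp: lookup_sum lookup_single when_def in_keys_iff sum.delta')

lemma mpoly_induct [case_names single add]:
  fixes p :: "'a \<Rightarrow>\<^sub>0 'b::comm_monoid_add"
  assumes single: "\<And>m c. P (Poly_Mapping.single m c)"
    and add: "\<And>p q. P p \<Longrightarrow> P q \<Longrightarrow> P (p + q)"
  shows "P p"
proof -
  have "P (\<Sum>m\<in>S. Poly_Mapping.single m (Poly_Mapping.lookup p m))" if "finite S" for S
    using that
  proof (induction S rule: finite_induct)
    case empty
    then show ?case using single[of undefined 0] by simp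
  qed (auto intro: single add)
  then show ?thesis
    using poly_mapping_sum_single[of p] by (metis finite_keys)
qed

text \<open>The coefficient map \<open>c\<close> is a parameter because the same evaluation is used
  with values in polynomial rings, fields, power series and Laurent series.\<close>

definition mev :: "('k \<Rightarrow> 'r) \<Rightarrow> ('v::finite \<Rightarrow> 'r) \<Rightarrow> ('v, 'k::comm_ring_1) mpoly \<Rightarrow> 'r::comm_ring_1" where
  "mev c x p = (\<Sum>m\<in>Poly_Mapping.keys p. c (Poly_Mapping.lookup p m) * (\<Prod>i\<in>UNIV. x i ^ Poly_Mapping.lookup m i))"

locale coeff_hom =
  fixes c :: "'k::comm_ring_1 \<Rightarrow> 'r::comm_ring_1"
  assumes c_add: "c (u + v) = c u + c v"
    and c_mult: "c (u * v) = c u * c v"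
    and c_1: "c 1 = 1"
begin

lemma c_0: "c 0 = 0"
  using c_add[of 0 0] by simp

lemma mev_superset:
  assumes "finite S" "Poly_Mapping.keys p \<subseteq> S"
  shows "mev c x p = (\<Sum>m\<in>S. c (Poly_Mapping.lookup p m) * (\<Prod>i\<in>UNIV. x i ^ Poly_Mapping.lookup m i))"
  unfolding mev_def using assms
  by (intro sum.mono_neutral_left) (auto simp: in_keys_iff c_0)

lemma mev_0 [simp]: "mev c x 0 = 0"
  by (simp add: mev_def)

lemma mev_add: "mev c x (p + q) = mev c x p + mev c x q"
proof -
  let ?S = "Poly_Mapping.keys p \<union> Poly_Mapping.keys q"
  show ?thesis
    using mev_superset[of ?S p x] mev_superset[of ?S q x] mev_superset[of ?S "p + q" x]
    by (simp add: Poly_Mapping.keys_add lookup_add c_add distrib_right sum.distrib)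
qed

lemma mev_sum: "mev c x (\<Sum>i\<in>I. f i) = (\<Sum>i\<in>I. mev c x (f i))"
  by (induction I rule: infinite_finite_induct) (auto simp: mev_add)

lemma mev_single: "mev c x (Poly_Mapping.single m u) = c u * (\<Prod>i\<in>UNIV. x i ^ Poly_Mapping.lookup m i)"
  by (simp add: mev_def c_0)

lemma mev_Cst [simp]: "mev c x (Cst u) = c u"
  by (simp add: Cst_def mev_single)

lemma mev_1 [simp]: "mev c x 1 = 1"
  using mev_Cst[of x 1] by (simp add: Cst_def c_1)

lemma mev_Xvar [simp]: "mev c x (Xvar i) = x i"
proof -
  have "(\<Prod>j\<in>UNIV. x j ^ Poly_Mapping.lookup (Poly_Mapping.single i (1::nat)) j) = (\<Prod>j\<in>UNIV. if j = i then x j else 1)"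
    by (rule prod.cong) (auto simp: lookup_single when_def)
  then show ?thesis by (simp add: Xvar_def mev_single c_1)
qed

lemma mev_mult: "mev c x (p * q) = mev c x p * mev c x q"
proof (induction p rule: mpoly_induct)
  case (single m u)
  show ?case
  proof (induction q rule: mpoly_induct)
    case (single n v)
    show ?case
      by (simp add: mult_single mev_single c_mult lookup_add power_add prod.distrib mult_ac)
  qed (simp add: mev_add distrib_left)
qed (simp add: mev_add distrib_right)

lemma mev_power: "mev c x (p ^ n) = mev c x p ^ n"
  by (induction n) (auto simp: mev_mult)

lemma mev_diff: "mev c x (p - q) = mev c x p - mev c x q"
  using mev_add[of x "p - q" q] by simp

lemma mev_uminus: "mev c x (- p) = - mev c x p"
  using mev_diff[of x 0 p] by simp

lemma mev_fermat: "mev c x (fermat a) = (\<Sum>i\<in>UNIV. x i ^ a i)"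
  by (simp add: fermat_def mev_sum mev_power)

text \<open>Change of target: used to pass from polynomials to the field \<open>gfield\<close>, and
  from power series to Laurent series.\<close>

lemma hom_mev:
  assumes "\<And>u v. h (u + v) = h u + h v" "\<And>u v. h (u * v) = h u * h v" "h 1 = 1"
  shows "h (mev c x p) = mev (\<lambda>u. h (c u)) (\<lambda>i. h (x i)) p"
proof -
  have h0: "h 0 = 0" using assms(1)[of 0 0] by simp
  have hp: "h (u ^ n) = h u ^ n" for u n by (induction n) (auto simp: assms)
  have hs: "h (\<Sum>i\<in>I. f i) = (\<Sum>i\<in>I. h (f i))" for f and I :: "('b \<Rightarrow>\<^sub>0 nat) set"
    by (induction I rule: infinite_finite_induct) (auto simp: assms h0)
  have hpr: "h (\<Prod>i\<in>I. f i) = (\<Prod>i\<in>I. h (f i))" for f and I :: "'b set"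
    by (induction I rule: infinite_finite_induct) (auto simp: assms)
  show ?thesis by (simp add: mev_def hs assms(2) hpr hp)
qed

lemma coeff_hom_comp:
  assumes "\<And>u v. h (u + v) = h u + h v" "\<And>u v. h (u * v) = h u * h v" "h 1 = 1"
  shows "coeff_hom (\<lambda>u. h (c u))"
  by standard (auto simp: assms c_add c_mult c_1)

end

lemma coeff_hom_Cst: "coeff_hom (Cst :: 'k::comm_ring_1 \<Rightarrow> ('v, 'k) mpoly)"
  by standard (auto simp: Cst_def single_add mult_single)

section \<open>The polynomial ring is a domain, and its variables stay independent in a closed
  field\<close>

lemma Xvar_power: "Xvar i ^ n = Poly_Mapping.single (Poly_Mapping.single i n) 1"
  by (induction n) (auto simp: Xvar_def mult_single single_add[symmetric])

lemma prod_Xvar: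
  assumes "finite I"
  shows "(\<Prod>i\<in>I. Xvar (f i) ^ n i) = Poly_Mapping.single (\<Sum>i\<in>I. Poly_Mapping.single (f i) (n i)) (1::'k::comm_ring_1)"
  using assms by (induction I rule: finite_induct) (auto simp: Xvar_power mult_single)

text \<open>An order on the variables yields one on the monomials, and comparing leading monomials
  excludes zero divisors. The index type \<open>'v\<close> carries no order, so its variables are
  renamed to natural numbers.\<close>

definition mpoly_nat :: "('v::finite \<Rightarrow> nat) \<Rightarrow> ('v, 'k::comm_ring_1) mpoly \<Rightarrow> (nat, 'k) mpoly" where
  "mpoly_nat f = mev Cst (\<lambda>i. Xvar (f i))"

lemma mpoly_nat_eq_0_iff:
  assumes "inj f"
  shows "mpoly_nat f p = 0 \<longleftrightarrow> p = 0"
proof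
  assume z: "mpoly_nat f p = 0"
  \<comment> \<open>\<open>g\<close> renames a monomial. As \<open>f\<close> is injective, the
    exponents can be read off again, so no two terms of \<open>p\<close> are merged.\<close>
  define g where "g m = (\<Sum>i\<in>UNIV. Poly_Mapping.single (f i) (Poly_Mapping.lookup m i))" for m :: "'a \<Rightarrow>\<^sub>0 nat"
  have lg: "Poly_Mapping.lookup (g m) (f j) = Poly_Mapping.lookup m j" for m j
    using assms by (simp add: g_def lookup_sum lookup_single when_def inj_eq)
  have g: "g m = g n \<longleftrightarrow> m = n" for m n
    using lg by (metis poly_mapping_eqI)
  have eq: "mpoly_nat f p = (\<Sum>m\<in>Poly_Mapping.keys p. Poly_Mapping.single (g m) (Poly_Mapping.lookup p m))"
    unfolding mpoly_nat_def mev_def by (simp add: prod_Xvar g_def Cst_def mult_single)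
  show "p = 0"
  proof (rule ccontr)
    assume "p \<noteq> 0"
    then obtain m where m: "m \<in> Poly_Mapping.keys p" by (metis poly_mapping_eqI in_keys_iff lookup_zero)
    have "Poly_Mapping.lookup (mpoly_nat f p) (g m) = Poly_Mapping.lookup p m"
      using m by (simp add: eq lookup_sum lookup_single when_def g sum.delta)
    with z m show False by (simp add: in_keys_iff)
  qed
next
  interpret coeff_hom "Cst :: 'b \<Rightarrow> (nat, 'b) mpoly" by (rule coeff_hom_Cst)
  show "p = 0 \<Longrightarrow> mpoly_nat f p = 0" by (simp add: mpoly_nat_def)
qed

lemma mpoly_mult_eq_0_iff:
  fixes p q :: "('v::finite, 'k::idom) mpoly"
  shows "p * q = 0 \<longleftrightarrow> p = 0 \<or> q = 0"
proof -
  obtain f :: "'v \<Rightarrow> nat" where "inj f"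
    using finite_imp_inj_to_nat_seg[of "UNIV :: 'v set"] by auto
  interpret coeff_hom "Cst :: 'k \<Rightarrow> (nat, 'k) mpoly" by (rule coeff_hom_Cst)
  have "p * q = 0 \<longleftrightarrow> mpoly_nat f p * mpoly_nat f q = 0"
    using mpoly_nat_eq_0_iff[OF \<open>inj f\<close>, of "p * q"] by (simp add: mpoly_nat_def mev_mult)
  then show ?thesis by (simp add: mpoly_nat_eq_0_iff[OF \<open>inj f\<close>])
qed

lemma mpoly_mult_left_cancel:
  fixes p q r :: "('v::finite, 'k::idom) mpoly"
  assumes "p \<noteq> 0" "p * q = p * r"
  shows "q = r"
  using assms mpoly_mult_eq_0_iff[of p "q - r"] by (simp add: right_diff_distrib)

instance fract :: ("{idom, ring_char_0}") field_char_0
proof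
  show "inj (of_nat :: nat \<Rightarrow> 'a fract)"
    by (rule injI) (simp add: of_nat_fract eq_fract)
qed

text \<open>An algebraically closed field of characteristic zero over \<open>'k\<close> with
  infinitely many independent elements: roots can be taken in it, and any finite family of variables
  has generic values there.\<close>

type_synonym 'k gfield = "(nat, 'k) mpoly fract alg_closure"

definition gcst :: "'k::field_char_0 \<Rightarrow> 'k gfield" where
  "gcst u = to_ac (Fract (Cst u) 1)"

definition gvar :: "('v::finite \<Rightarrow> nat) \<Rightarrow> 'v \<Rightarrow> 'k::field_char_0 gfield" where
  "gvar f i = to_ac (Fract (Xvar (f i)) 1)"

lemma coeff_hom_gcst: "coeff_hom gcst"
proof -
  interpret coeff_hom "Cst :: 'a \<Rightarrow> (nat, 'a) mpoly" by (rule coeff_hom_Cst)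
  show ?thesis
    by standard (auto simp: gcst_def c_add c_mult c_1 One_fract_def[symmetric] simp flip: to_ac_add to_ac_mult)
qed

text \<open>The polynomial ring, its fraction field and the algebraic closure are embedded in each
  other, so the elements \<open>gvar f i\<close> are algebraically independent over the
  constants.\<close>

lemma mev_gvar_eq_0_iff:
  assumes "inj f"
  shows "mev gcst (gvar f) p = 0 \<longleftrightarrow> p = 0"
proof -
  interpret coeff_hom "Cst :: 'b \<Rightarrow> (nat, 'b) mpoly" by (rule coeff_hom_Cst)
  have "to_ac (Fract (mpoly_nat f p) 1) = mev gcst (gvar f) p"
    unfolding mpoly_nat_def gcst_def gvar_def
    by (rule hom_mev) (auto simp: One_fract_def[symmetric] simp flip: to_ac_add to_ac_mult)
  moreover have "Fract (mpoly_nat f p) 1 = 0 \<longleftrightarrow> mpoly_nat f p = 0"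
    by (simp add: Zero_fract_def eq_fract)
  ultimately show ?thesis
    using mpoly_nat_eq_0_iff[OF assms, of p] by (metis to_ac_eq_0_iff)
qed

section \<open>A generic zero of the Fermat polynomial\<close>

text \<open>The exponents are positive, so the powers are pairwise distinct monomials and nothing
  cancels the coefficient of \<open>Xvar x ^ a x\<close>.\<close>

lemma sum_Xvar_powers_neq_0:
  fixes x :: "'v::finite"
  assumes "x \<in> I" "\<And>i. a i > 0"
  shows "(\<Sum>i\<in>I. Xvar i ^ a i :: ('v, 'k::comm_ring_1) mpoly) \<noteq> 0"
proof -
  have eq: "Poly_Mapping.single i (a i) = Poly_Mapping.single x (a x) \<longleftrightarrow> i = x" for i
    using assms(2)[of i] assms(2)[of x]
    by (metis lookup_single_eq lookup_single_not_eq less_numeral_extra(3))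
  have "Poly_Mapping.lookup (\<Sum>i\<in>I. Xvar i ^ a i :: ('v, 'k) mpoly) (Poly_Mapping.single x (a x)) = 1"
    using assms(1)
    by (simp add: Xvar_power lookup_sum lookup_single when_def eq)
  then show ?thesis by fastforce
qed

text \<open>The Fermat polynomial is monic in the variable \<open>j\<close>: the power
  \<open>Xvar j ^ a j\<close> can be replaced by minus the sum of the other powers until the
  exponent at \<open>j\<close> is below \<open>a j\<close>.\<close>

lemma fermat_division:
  fixes p :: "('v::finite, 'k::comm_ring_1) mpoly"
  assumes a: "\<And>i. a i > 0"
  shows "\<exists>q r. p = fermat a * q + r \<and> (\<forall>m\<in>Poly_Mapping.keys r. Poly_Mapping.lookup m j < a j)"
    (is "?P p")
proof -
  have add: "?P (p + q)" if "?P p" "?P q" for p q :: "('v, 'k) mpoly"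
  proof -
    from that obtain q1 r1 q2 r2 where e: "p = fermat a * q1 + r1" "q = fermat a * q2 + r2"
      and k: "\<forall>m\<in>Poly_Mapping.keys r1. Poly_Mapping.lookup m j < a j"
        "\<forall>m\<in>Poly_Mapping.keys r2. Poly_Mapping.lookup m j < a j" by blast
    have "p + q = fermat a * (q1 + q2) + (r1 + r2)"
      by (simp add: e algebra_simps)
    moreover have "\<forall>m\<in>Poly_Mapping.keys (r1 + r2). Poly_Mapping.lookup m j < a j"
      using k Poly_Mapping.keys_add[of r1 r2] by blast
    ultimately show ?thesis by blast
  qed
  have zero: "?P 0"
    by (rule exI[of _ 0], rule exI[of _ 0]) simp
  have sum: "?P (\<Sum>i\<in>I. h i)" if "\<And>i. i \<in> I \<Longrightarrow> ?P (h i)" for I :: "'v set" and h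
    using finite[of I] that
  proof (induction I rule: finite_induct)
    case (insert x F)
    then show ?case using add[of "h x" "sum h F"] by simp
  qed (use zero in simp_all)
  have mono: "?P (Poly_Mapping.single m u)" for m u
  proof (induction "Poly_Mapping.lookup m j" arbitrary: m u rule: less_induct)
    case less
    show ?case
    proof (cases "Poly_Mapping.lookup m j < a j")
      case True
      then have "\<forall>m\<in>Poly_Mapping.keys (Poly_Mapping.single m u). Poly_Mapping.lookup m j < a j"
        by (simp split: if_splits)
      then show ?thesis by (intro exI[of _ 0] exI[of _ "Poly_Mapping.single m u"]) simp
    next
      case False
      define n where "n = m - Poly_Mapping.single j (a j)"
      have m: "m = n + Poly_Mapping.single j (a j)"
        by (rule poly_mapping_eqI) (use False in \<open>auto simp: n_def lookup_minus lookup_add lookup_single when_def\<close>)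
      \<comment> \<open>The terms produced by one replacement. For \<open>i\<close> other than
        \<open>j\<close> their exponent at \<open>j\<close> is that of \<open>n\<close>, hence
        smaller than before by the positive number \<open>a j\<close>.\<close>
      define h where "h i = Poly_Mapping.single (n + Poly_Mapping.single i (a i)) (- u)" for i
      have h: "h i = - (Poly_Mapping.single n u * Xvar i ^ a i)" for i
        by (simp add: h_def Xvar_power mult_single single_uminus)
      have "?P (h i)" if "i \<noteq> j" for i
        unfolding h_def
        by (rule less) (use that a[of j] in \<open>auto simp: m lookup_add lookup_single when_def\<close>)
      then have "?P (\<Sum>i\<in>UNIV - {j}. h i)" by (intro sum) auto
      moreover have "?P (fermat a * Poly_Mapping.single n u)"
        by (rule exI[of _ "Poly_Mapping.single n u"], rule exI[of _ 0]) simp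
      moreover have "Poly_Mapping.single m u = fermat a * Poly_Mapping.single n u + (\<Sum>i\<in>UNIV - {j}. h i)"
      proof -
        have "fermat a * Poly_Mapping.single n u = (\<Sum>i\<in>UNIV. Poly_Mapping.single n u * Xvar i ^ a i)"
          by (simp add: fermat_def sum_distrib_left mult.commute)
        also have "\<dots> = Poly_Mapping.single n u * Xvar j ^ a j + (\<Sum>i\<in>UNIV - {j}. Poly_Mapping.single n u * Xvar i ^ a i)"
          by (subst sum.remove[of _ j]) auto
        also have "Poly_Mapping.single n u * Xvar j ^ a j = Poly_Mapping.single m u"
          by (simp add: Xvar_power mult_single m)
        finally show ?thesis by (simp add: h sum_negf)
      qed
      ultimately show ?thesis using add by presburger
    qed
  qed
  show ?thesis
    by (induction p rule: mpoly_induct) (use mono add in blast)+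
qed

text \<open>Differentiating an algebraic relation yields one of smaller degree.\<close>

lemma fps_transcendental:
  fixes F :: "'a::field_char_0 fps"
  assumes "fps_deriv F \<noteq> 0" "(\<Sum>l\<le>n. fps_const (d l) * F ^ l) = 0" "l \<le> n"
  shows "d l = 0"
  using assms(2,3)
proof (induction n arbitrary: d l)
  case 0
  then show ?case by simp
next
  case (Suc n)
  have "0 = fps_deriv (\<Sum>l\<le>Suc n. fps_const (d l) * F ^ l)"
    by (simp only: Suc.prems) simp
  also have "\<dots> = (\<Sum>l\<le>Suc n. fps_const (d l) * (of_nat l * fps_deriv F * F ^ (l - 1)))"
    by (simp only: fps_deriv_sum fps_deriv_mult_const_left fps_deriv_power')
  also have "\<dots> = (\<Sum>l\<le>n. fps_const (d (Suc l)) * (of_nat (Suc l) * fps_deriv F * F ^ l))"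
    by (subst sum.atMost_Suc_shift) simp
  also have "\<dots> = fps_deriv F * (\<Sum>l\<le>n. fps_const (of_nat (Suc l) * d (Suc l)) * F ^ l)"
    unfolding sum_distrib_left
    by (intro sum.cong refl) (simp add: fps_const_mult[symmetric] fps_of_nat[symmetric] mult_ac del: fps_const_mult of_nat_Suc)
  finally have "(\<Sum>l\<le>n. fps_const (of_nat (Suc l) * d (Suc l)) * F ^ l) = 0"
    using assms(1) by simp
  then have "of_nat (Suc l) * d (Suc l) = 0" if "l \<le> n" for l
    using Suc.IH[of "\<lambda>l. of_nat (Suc l) * d (Suc l)"] that by blast
  then have pos: "d (Suc l) = 0" if "l \<le> n" for l
    using that of_nat_neq_0 by (metis mult_eq_0_iff)
  have "d 0 = 0"
    using Suc.prems(1) pos by (subst (asm) sum.atMost_Suc_shift) simp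
  then show ?case using pos Suc.prems(2) by (cases l) auto
qed

text \<open>The constant term has a root in the closed field, and in characteristic zero a root of a
  nonzero constant term extends to a root of the series.\<close>

lemma fps_root_exists:
  fixes F :: "'a::{alg_closed_field, field_char_0} fps"
  assumes "F $ 0 \<noteq> 0" "n > 0"
  shows "\<exists>G. G ^ n = F"
proof -
  obtain y where y: "y ^ n = F $ 0"
    using nth_root_exists[of n "F $ 0"] assms(2) by auto
  obtain k where k: "n = Suc k" using assms(2) by (cases n) auto
  show ?thesis
    using power_radical[of F "\<lambda>_ _. y" k] assms(1) y by (auto simp: k)
qed

lemma fps_const_sum: "fps_const (\<Sum>i\<in>I. h i) = (\<Sum>i\<in>I. fps_const (h i))"
  by (induction I rule: infinite_finite_induct) (auto simp flip: fps_const_add)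

lemma fps_const_prod: "fps_const (\<Prod>i\<in>I. h i) = (\<Prod>i\<in>I. fps_const (h i))"
  by (induction I rule: infinite_finite_induct) (auto simp flip: fps_const_mult)

text \<open>In the power series \<open>u\<close> and \<open>\<Xi>(u\<^sup>b)\<close> substituted for the variables \<open>j2\<close> and \<open>j1\<close>, the second has
  only exponents divisible by \<open>b\<close>; so the terms of a reduced polynomial with different exponents at \<open>j2\<close>
  contribute to different residue classes modulo \<open>b\<close> and cannot cancel.\<close>

lemma reduced_poly_nonzero_at_point:
  fixes a :: "'v::finite \<Rightarrow> nat" and f :: "'v \<Rightarrow> nat" and r :: "('v, 'k::field_char_0) mpoly"
    and \<Xi> :: "'k gfield fps"
  assumes "inj f" "j1 \<noteq> j2" "b > 0" "fps_deriv \<Xi> \<noteq> 0"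
    and red: "\<forall>m\<in>Poly_Mapping.keys r. Poly_Mapping.lookup m j2 < b"
    and x_def: "x = (\<lambda>i. if i = j2 then fps_X else if i = j1 then fps_compose \<Xi> (fps_X ^ b) else fps_const (gvar f i))"
    and zero: "mev (\<lambda>u. fps_const (gcst u)) x r = 0"
  shows "r = 0"
proof -
  interpret coeff_hom "gcst :: 'k \<Rightarrow> _" by (rule coeff_hom_gcst)
  interpret C: coeff_hom "\<lambda>u::'k. fps_const (gcst u)"
    by (rule coeff_hom_comp) auto
  define K where "K = Poly_Mapping.keys r"
  have [simp]: "finite K" by (simp add: K_def)
  define w where "w m = gcst (Poly_Mapping.lookup r m) * (\<Prod>i\<in>UNIV - {j1, j2}. gvar f i ^ Poly_Mapping.lookup m i)" for m
  obtain N where N: "\<And>m. m \<in> K \<Longrightarrow> Poly_Mapping.lookup m j1 \<le> N"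
    using finite_imageI[OF \<open>finite K\<close>, of "\<lambda>m. Poly_Mapping.lookup m j1"]
    unfolding finite_nat_set_iff_bounded_le by blast
  \<comment> \<open>\<open>d e l\<close> is the coefficient for the exponents \<open>e\<close> at
    \<open>j2\<close> and \<open>l\<close> at \<open>j1\<close>, with the remaining variables at
    their generic values. \<open>Q e\<close> is the part with exponent \<open>e\<close> as a
    polynomial in \<open>\<Xi>\<close>, before \<open>fps_X ^ b\<close> is substituted.\<close>
  define d where "d e l = (\<Sum>m\<in>{m\<in>K. Poly_Mapping.lookup m j2 = e \<and> Poly_Mapping.lookup m j1 = l}. w m)" for e l
  define Q where "Q e = (\<Sum>l\<le>N. fps_const (d e l) * \<Xi> ^ l)" for e
  have split_prod: "(\<Prod>i\<in>UNIV. y i) = y j1 * y j2 * (\<Prod>i\<in>UNIV - {j1, j2}. y i)" for y :: "'v \<Rightarrow> 'c::comm_monoid_mult"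
  proof -
    have "UNIV - {j1} - {j2} = UNIV - {j1, j2}" by auto
    then show ?thesis
      using assms(2) by (simp add: prod.remove[of UNIV j1] prod.remove[of "UNIV - {j1}" j2] mult.assoc)
  qed
  let ?xi = "fps_compose \<Xi> (fps_X ^ b)"
  have Qb: "fps_compose (Q e) (fps_X ^ b) = (\<Sum>m\<in>{m\<in>K. Poly_Mapping.lookup m j2 = e}. fps_const (w m) * ?xi ^ Poly_Mapping.lookup m j1)" for e
  proof -
    have "fps_compose (Q e) (fps_X ^ b) = (\<Sum>l\<le>N. fps_const (d e l) * ?xi ^ l)"
      using assms(3) by (simp add: Q_def fps_compose_sum_distrib fps_compose_mult_distrib fps_compose_power)
    also have "\<dots> = (\<Sum>l\<le>N. \<Sum>m\<in>{m\<in>{m\<in>K. Poly_Mapping.lookup m j2 = e}. Poly_Mapping.lookup m j1 = l}. fps_const (w m) * ?xi ^ Poly_Mapping.lookup m j1)"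
      by (rule sum.cong) (auto simp: d_def fps_const_sum sum_distrib_right intro!: sum.cong)
    also have "\<dots> = (\<Sum>m\<in>{m\<in>K. Poly_Mapping.lookup m j2 = e}. fps_const (w m) * ?xi ^ Poly_Mapping.lookup m j1)"
      by (rule sum.group) (auto intro: N)
    finally show ?thesis .
  qed
  have "mev (\<lambda>u. fps_const (gcst u)) x r = (\<Sum>m\<in>K. fps_X ^ Poly_Mapping.lookup m j2 * (fps_const (w m) * ?xi ^ Poly_Mapping.lookup m j1))"
    unfolding mev_def K_def[symmetric]
  proof (rule sum.cong)
    fix m
    have "(\<Prod>i\<in>UNIV - {j1, j2}. x i ^ Poly_Mapping.lookup m i) = (\<Prod>i\<in>UNIV - {j1, j2}. fps_const (gvar f i ^ Poly_Mapping.lookup m i))"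
      by (rule prod.cong) (auto simp: x_def fps_const_power)
    also have "\<dots> = fps_const (\<Prod>i\<in>UNIV - {j1, j2}. gvar f i ^ Poly_Mapping.lookup m i)"
      by (simp only: fps_const_prod)
    finally show "fps_const (gcst (Poly_Mapping.lookup r m)) * (\<Prod>i\<in>UNIV. x i ^ Poly_Mapping.lookup m i) =
        fps_X ^ Poly_Mapping.lookup m j2 * (fps_const (w m) * ?xi ^ Poly_Mapping.lookup m j1)"
      using assms(2) by (simp add: split_prod w_def x_def fps_const_mult[symmetric] mult_ac del: fps_const_mult)
  qed simp
  also have "\<dots> = (\<Sum>e<b. \<Sum>m\<in>{m\<in>K. Poly_Mapping.lookup m j2 = e}. fps_X ^ Poly_Mapping.lookup m j2 * (fps_const (w m) * ?xi ^ Poly_Mapping.lookup m j1))"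
    by (rule sum.group[symmetric]) (use red K_def in auto)
  also have "\<dots> = (\<Sum>e<b. fps_X ^ e * fps_compose (Q e) (fps_X ^ b))"
    by (rule sum.cong) (auto simp: Qb sum_distrib_left intro!: sum.cong)
  finally have S: "(\<Sum>e<b. fps_X ^ e * fps_compose (Q e) (fps_X ^ b)) = 0"
    using zero by simp
  \<comment> \<open>Among the exponents below \<open>b\<close> only \<open>e\<close> is congruent to
    \<open>e + b * q\<close> modulo \<open>b\<close>; so the coefficient at that position sees no
    other summand and equals \<open>Q e $ q\<close>.\<close>
  have Q0: "Q e = 0" if e: "e < b" for e
  proof (rule fps_ext)
    fix q
    have "0 = (\<Sum>e'<b. fps_X ^ e' * fps_compose (Q e') (fps_X ^ b)) $ (e + b * q)"
      by (simp add: S)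
    also have "\<dots> = (\<Sum>e'<b. if e' = e then Q e $ q else 0)"
      unfolding fps_sum_nth
    proof (rule sum.cong)
      fix e' assume e': "e' \<in> {..<b}"
      show "(fps_X ^ e' * fps_compose (Q e') (fps_X ^ b)) $ (e + b * q) = (if e' = e then Q e $ q else 0)"
      proof (cases "e + b * q < e'")
        case True
        then show ?thesis by (auto simp: fps_X_power_mult_nth)
      next
        case False
        have "b dvd e + b * q - e' \<longleftrightarrow> e' = e"
        proof
          assume "b dvd e + b * q - e'"
          then obtain k where "e + b * q - e' = b * k" by blast
          then have "e + b * q = e' + b * k" using False by linarith
          then have "(e + b * q) mod b = (e' + b * k) mod b" by simp
          then show "e' = e" using e e' by simp
        qed simp
        then show ?thesis using False \<open>b > 0\<close>
          by (auto simp: fps_X_power_mult_nth fps_nth_compose_X_power)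
      qed
    qed simp
    also have "\<dots> = Q e $ q" using e by simp
    finally show "Q e $ q = 0 $ q" by simp
  qed
  show "r = 0"
  proof (rule ccontr)
    assume "r \<noteq> 0"
    then obtain m0 where m0: "m0 \<in> K" by (metis K_def poly_mapping_eqI in_keys_iff lookup_zero)
    define e l where "e = Poly_Mapping.lookup m0 j2" and "l = Poly_Mapping.lookup m0 j1"
    define S where "S = {m\<in>K. Poly_Mapping.lookup m j2 = e \<and> Poly_Mapping.lookup m j1 = l}"
    have "e < b" "l \<le> N" using red m0 N by (auto simp: e_def l_def K_def)
    then have dz: "d e l = 0"
      using fps_transcendental[OF assms(4), where n = N and d = "d e" and l = l] Q0[of e] by (simp add: Q_def)
    \<comment> \<open>\<open>r'\<close> collects the terms of \<open>r\<close> with exponents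
      \<open>e\<close> and \<open>l\<close>. Its generic value is a multiple of
      \<open>d e l\<close>, hence zero; by independence \<open>r'\<close> itself vanishes, although
      it contains the term \<open>m0\<close>.\<close>
    define r' where "r' = (\<Sum>m\<in>S. Poly_Mapping.single m (Poly_Mapping.lookup r m))"
    have "mev gcst (gvar f) r' = (\<Sum>m\<in>S. w m * (gvar f j1 ^ l * gvar f j2 ^ e))"
      unfolding r'_def mev_sum
      by (rule sum.cong) (auto simp: mev_single split_prod w_def S_def mult_ac)
    also have "\<dots> = d e l * (gvar f j1 ^ l * gvar f j2 ^ e)"
      by (simp add: d_def S_def sum_distrib_right)
    finally have "r' = 0" using dz by (simp add: mev_gvar_eq_0_iff[OF assms(1)])
    moreover have "Poly_Mapping.lookup r' m0 = Poly_Mapping.lookup r m0"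
    proof -
      have "m0 \<in> S" "finite S" using m0 by (auto simp: S_def e_def l_def)
      then show ?thesis by (simp add: r'_def lookup_sum lookup_single when_def)
    qed
    ultimately show False using m0 by (simp add: K_def in_keys_iff)
  qed
qed

text \<open>Variable \<open>j2\<close> becomes \<open>u\<close>, all others except \<open>j1\<close>
  become independent constants, and \<open>j1\<close> becomes a root that makes the Fermat sum
  vanish. If a polynomial vanishes at this point, so does its remainder after division in the
  variable \<open>j2\<close>, and a reduced remainder vanishing there is zero.\<close>

lemma fermat_generic_point:
  fixes a :: "'v::finite \<Rightarrow> nat"
  assumes "card (UNIV :: 'v set) \<ge> 3" and a: "\<And>i. a i > 0"
  shows "\<exists>(c :: 'k::field_char_0 \<Rightarrow> 'k gfield fls) x. coeff_hom c \<and> (\<forall>p. mev c x p = 0 \<longleftrightarrow> fermat a dvd p)"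
proof -
  obtain f :: "'v \<Rightarrow> nat" where f: "inj f"
    using finite_imp_inj_to_nat_seg[of "UNIV :: 'v set"] by auto
  obtain T :: "'v set" where "card T = 3" using obtain_subset_with_card_n[OF assms(1)] by blast
  then obtain j1 j2 j3 :: 'v where j: "j1 \<noteq> j2" "j3 \<noteq> j1" "j3 \<noteq> j2"
    by (auto simp: card_3_iff)
  define b where "b = a j2"
  have b: "b > 0" using a by (simp add: b_def)
  interpret coeff_hom "gcst :: 'k \<Rightarrow> _" by (rule coeff_hom_gcst)
  interpret C: coeff_hom "\<lambda>u::'k. fps_const (gcst u)"
    by (rule coeff_hom_comp) auto
  define g where "g = (\<Sum>i\<in>UNIV - {j1, j2}. gvar f i ^ a i :: 'k gfield)"
  have "g = mev gcst (gvar f) (\<Sum>i\<in>UNIV - {j1, j2}. Xvar i ^ a i :: ('v, 'k) mpoly)"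
    by (simp add: g_def mev_sum mev_power)
  moreover have "(\<Sum>i\<in>UNIV - {j1, j2}. Xvar i ^ a i :: ('v, 'k) mpoly) \<noteq> 0"
    by (rule sum_Xvar_powers_neq_0[of j3]) (use j a in auto)
  ultimately have g: "g \<noteq> 0" by (simp add: mev_gvar_eq_0_iff[OF f])
  \<comment> \<open>With \<open>fps_X\<close> standing for \<open>u\<^sup>b\<close>, this solves the
    Fermat equation for the variable \<open>j1\<close>. The root exists because the constant term is
    \<open>- g\<close>, which is nonzero thanks to the third variable \<open>j3\<close>.\<close>
  obtain \<Xi> where X: "\<Xi> ^ a j1 = - (fps_const g + fps_X)"
    using fps_root_exists[of "- (fps_const g + fps_X)" "a j1"] g a by auto
  have X': "fps_deriv \<Xi> \<noteq> 0"
  proof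
    assume z: "fps_deriv \<Xi> = 0"
    have "fps_deriv (\<Xi> ^ a j1) = 0"
      unfolding fps_deriv_power' z by simp
    then show False by (simp add: X)
  qed
  define x where "x = (\<lambda>i. if i = j2 then fps_X else if i = j1 then fps_compose \<Xi> (fps_X ^ b) else fps_const (gvar f i))"
  have xf: "mev (\<lambda>u::'k. fps_const (gcst u)) x (fermat a) = 0"
  proof -
    have "(\<Sum>i\<in>UNIV. x i ^ a i) = x j1 ^ a j1 + (x j2 ^ a j2 + (\<Sum>i\<in>UNIV - {j1} - {j2}. x i ^ a i))"
      using j by (simp add: sum.remove[of UNIV j1] sum.remove[of "UNIV - {j1}" j2])
    also have "(\<Sum>i\<in>UNIV - {j1} - {j2}. x i ^ a i) = (\<Sum>i\<in>UNIV - {j1, j2}. fps_const (gvar f i ^ a i))"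
      by (rule sum.cong) (auto simp: x_def fps_const_power)
    also have "\<dots> = fps_const g" by (simp add: g_def fps_const_sum)
    also have "x j1 ^ a j1 = fps_compose (\<Xi> ^ a j1) (fps_X ^ b)"
      using j b by (simp add: x_def fps_compose_power)
    also have "\<dots> = - (fps_const g + fps_X ^ b)"
      using b by (simp add: X fps_compose_uminus[symmetric] fps_compose_add_distrib fps_compose_sub_distrib)
    also have "x j2 = fps_X" by (simp add: x_def)
    finally show ?thesis by (simp add: C.mev_fermat b_def)
  qed
  have ker: "mev (\<lambda>u. fps_const (gcst u)) x p = 0 \<longleftrightarrow> fermat a dvd p" for p :: "('v, 'k) mpoly"
  proof
    assume z: "mev (\<lambda>u. fps_const (gcst u)) x p = 0"
    obtain q r where qr: "p = fermat a * q + r" "\<forall>m\<in>Poly_Mapping.keys r. Poly_Mapping.lookup m j2 < b"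
      using fermat_division[of a p j2] a unfolding b_def by blast
    have "mev (\<lambda>u. fps_const (gcst u)) x r = 0"
      using z by (simp add: qr(1) C.mev_add C.mev_mult xf)
    then have "r = 0"
      by (rule reduced_poly_nonzero_at_point[OF f j(1) b X' qr(2) x_def])
    then show "fermat a dvd p" using qr by simp
  next
    assume "fermat a dvd p"
    then show "mev (\<lambda>u. fps_const (gcst u)) x p = 0" by (auto simp: dvd_def C.mev_mult xf)
  qed
  have hom: "fps_to_fls (mev (\<lambda>u. fps_const (gcst u)) x p) = mev (\<lambda>u. fps_to_fls (fps_const (gcst u))) (\<lambda>i. fps_to_fls (x i)) p"
    for p :: "('v, 'k) mpoly"
    by (rule C.hom_mev) (auto simp: fls_times_fps_to_fls)
  have "coeff_hom (\<lambda>u::'k. fps_to_fls (fps_const (gcst u)))"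
    by (rule C.coeff_hom_comp) (auto simp: fls_times_fps_to_fls)
  moreover have "mev (\<lambda>u::'k. fps_to_fls (fps_const (gcst u))) (\<lambda>i. fps_to_fls (x i)) p = 0 \<longleftrightarrow> fermat a dvd p" for p
    unfolding hom[symmetric] fps_to_fls_eq_0_iff by (rule ker)
  ultimately show ?thesis by blast
qed

section \<open>Locally nilpotent derivations of graded domains\<close>

lemma zspan_sum:
  assumes "x \<in> zspan S" "y \<in> zspan S"
  shows "x + y \<in> zspan S"
  using assms(2)
proof (induction y rule: zspan.induct)
  case (plus g y)
  then show ?case using zspan.plus[of g S "x + y"] by (simp add: add.assoc)
next
  case (minus g y)
  then show ?case using zspan.minus[of g S "x + y"] by (simp add: add_diff_eq)
qed (simp add: assms(1))

lemma zspan_uminus: "x \<in> zspan S \<Longrightarrow> - x \<in> zspan S"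
proof (induction x rule: zspan.induct)
  case (plus g x)
  then show ?case using zspan.minus[of g S "- x"] by simp
next
  case (minus g x)
  then show ?case using zspan.plus[of g S "- x"] by simp
qed (simp add: zspan.zero)

lemma zspan_mult: "x \<in> zspan S \<Longrightarrow> k * x \<in> zspan S"
proof -
  assume x: "x \<in> zspan S"
  have nat: "int n * x \<in> zspan S" for n
    by (induction n) (auto simp: zspan.zero distrib_right intro!: zspan_sum x)
  show ?thesis
    by (cases k rule: int_cases2) (use nat zspan_uminus[OF nat] in auto)
qed

lemma zspan_base: "x \<in> S \<Longrightarrow> x \<in> zspan S"
  using zspan.plus[of x S 0] zspan.zero by simp

text \<open>The ring is taken inside a field, which makes it a domain and lets its fractions be
  formed directly.\<close>

locale graded_domain =
  fixes B :: "'f::field_char_0 set" and G :: "int \<Rightarrow> 'f set"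
  assumes B_add: "x \<in> B \<Longrightarrow> y \<in> B \<Longrightarrow> x + y \<in> B"
    and B_mult: "x \<in> B \<Longrightarrow> y \<in> B \<Longrightarrow> x * y \<in> B"
    and G_B: "x \<in> G d \<Longrightarrow> x \<in> B"
    and G_0: "0 \<in> G d"
    and G_1: "1 \<in> G 0"
    and G_add: "x \<in> G d \<Longrightarrow> y \<in> G d \<Longrightarrow> x + y \<in> G d"
    and G_uminus: "x \<in> G d \<Longrightarrow> - x \<in> G d"
    and G_mult: "x \<in> G d \<Longrightarrow> y \<in> G d' \<Longrightarrow> x * y \<in> G (d + d')"
begin

lemma B_0: "0 \<in> B" using G_0 G_B by blast

lemma B_1: "1 \<in> B" using G_1 G_B by blast

lemma B_power: "x \<in> B \<Longrightarrow> x ^ n \<in> B"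
  by (induction n) (auto intro: B_1 B_mult)

lemma B_sum: "(\<And>i. i \<in> I \<Longrightarrow> h i \<in> B) \<Longrightarrow> (\<Sum>i\<in>I. h i) \<in> B"
  by (induction I rule: infinite_finite_induct) (auto intro: B_0 B_add)

lemma G_sum: "(\<And>i. i \<in> I \<Longrightarrow> h i \<in> G d) \<Longrightarrow> (\<Sum>i\<in>I. h i) \<in> G d"
  by (induction I rule: infinite_finite_induct) (auto intro: G_0 G_add)

lemma G_diff: "x \<in> G d \<Longrightarrow> y \<in> G d \<Longrightarrow> x - y \<in> G d"
  using G_add[of x d "- y"] G_uminus[of y d] by simp

lemma G_of_nat_mult: "x \<in> G d \<Longrightarrow> of_nat n * x \<in> G d"
  by (induction n) (auto intro: G_0 G_add simp: distrib_right)

lemma G_of_nat: "of_nat n \<in> G 0"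
  using G_of_nat_mult[OF G_1, of n] by simp

lemma B_of_nat: "of_nat n \<in> B"
  using G_of_nat G_B by blast

lemma G_power: "x \<in> G d \<Longrightarrow> x ^ n \<in> G (int n * d)"
proof (induction n)
  case (Suc n)
  then show ?case using G_mult[of x d "x ^ n" "int n * d"] by (simp add: algebra_simps)
qed (simp add: G_1)

lemma poly_in_B:
  assumes "\<And>j. coeff p j \<in> B" "s \<in> B"
  shows "poly p s \<in> B"
  unfolding poly_altdef by (intro B_sum B_mult B_power assms)

end

section \<open>Kernel and iterates of a locally nilpotent derivation\<close>

locale lnd = graded_domain +
  fixes D
  assumes D_B: "x \<in> B \<Longrightarrow> D x \<in> B"
    and D_add: "x \<in> B \<Longrightarrow> y \<in> B \<Longrightarrow> D (x + y) = D x + D y"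
    and D_mult: "x \<in> B \<Longrightarrow> y \<in> B \<Longrightarrow> D (x * y) = x * D y + D x * y"
    and D_nilp: "x \<in> B \<Longrightarrow> \<exists>m. (D ^^ m) x = 0"
begin

lemma D_0 [simp]: "D 0 = 0"
  using D_add[OF B_0 B_0] by simp

lemma D_1 [simp]: "D 1 = 0"
  using D_mult[OF B_1 B_1] by simp

lemma D_of_nat [simp]: "D (of_nat n) = 0"
  by (induction n) (auto simp: D_add B_1 B_of_nat)

lemma D_sum: "(\<And>i. i \<in> I \<Longrightarrow> h i \<in> B) \<Longrightarrow> D (\<Sum>i\<in>I. h i) = (\<Sum>i\<in>I. D (h i))"
  by (induction I rule: infinite_finite_induct) (auto simp: D_add B_sum)

lemma Dn_B: "x \<in> B \<Longrightarrow> (D ^^ n) x \<in> B"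
  by (induction n) (auto intro: D_B)

lemma Dn_0 [simp]: "(D ^^ n) 0 = 0"
  by (induction n) auto

lemma Dn_add: "x \<in> B \<Longrightarrow> y \<in> B \<Longrightarrow> (D ^^ n) (x + y) = (D ^^ n) x + (D ^^ n) y"
  by (induction n) (auto simp: D_add Dn_B)

definition "A = {x \<in> B. D x = 0}"

lemma A_B: "x \<in> A \<Longrightarrow> x \<in> B"
  by (simp add: A_def)

lemma A_0: "0 \<in> A" by (simp add: A_def B_0)

lemma A_1: "1 \<in> A" by (simp add: A_def B_1)

lemma A_of_nat: "of_nat n \<in> A" by (simp add: A_def B_of_nat)

lemma A_add: "x \<in> A \<Longrightarrow> y \<in> A \<Longrightarrow> x + y \<in> A"
  by (simp add: A_def B_add D_add)

lemma A_mult: "x \<in> A \<Longrightarrow> y \<in> A \<Longrightarrow> x * y \<in> A"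
  by (simp add: A_def B_mult D_mult)

lemma A_power: "x \<in> A \<Longrightarrow> x ^ n \<in> A"
  by (induction n) (auto intro: A_1 A_mult)

lemma A_prod: "(\<And>i. i \<in> I \<Longrightarrow> h i \<in> A) \<Longrightarrow> (\<Prod>i\<in>I. h i) \<in> A"
  by (induction I rule: infinite_finite_induct) (auto intro: A_1 A_mult)

lemma D_A_mult: "c \<in> A \<Longrightarrow> x \<in> B \<Longrightarrow> D (c * x) = c * D x"
  by (simp add: A_def D_mult)

lemma Dn_A_mult: "c \<in> A \<Longrightarrow> x \<in> B \<Longrightarrow> (D ^^ n) (c * x) = c * (D ^^ n) x"
  by (induction n) (auto simp: D_A_mult Dn_B)

text \<open>Applied to the derivative of a variable this produces a local slice; applied to a factor
  of a kernel element it gives the degree needed for factorial closedness.\<close>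

lemma last_nonzero:
  assumes "x \<in> B" "x \<noteq> 0"
  obtains r where "(D ^^ r) x \<noteq> 0" "(D ^^ Suc r) x = 0"
proof -
  define m where "m = (LEAST m. (D ^^ m) x = 0)"
  have m: "(D ^^ m) x = 0" unfolding m_def using D_nilp[OF assms(1)] by (rule LeastI_ex)
  then have "m \<noteq> 0" using assms(2) by (cases m) auto
  then obtain r where "m = Suc r" by (cases m) auto
  moreover have "(D ^^ r) x \<noteq> 0"
    using not_less_Least[of r "\<lambda>m. (D ^^ m) x = 0"] calculation m_def by auto
  ultimately show ?thesis using m that by blast
qed

end

section \<open>Local slices\<close>

locale local_slice = lnd +
  fixes s
  assumes s_B: "s \<in> B" and Ds: "D s \<noteq> 0" and DDs: "D (D s) = 0"
begin

abbreviation "\<alpha> \<equiv> D s"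

lemma \<alpha>_A: "\<alpha> \<in> A"
  by (simp add: A_def s_B D_B DDs)

lemma D_s_power: "D (s ^ Suc n) = of_nat (Suc n) * \<alpha> * s ^ n"
proof (induction n)
  case (Suc n)
  have "D (s ^ Suc (Suc n)) = s * D (s ^ Suc n) + \<alpha> * s ^ Suc n"
    using D_mult[OF s_B B_power[OF s_B, of "Suc n"]] by simp
  then show ?case unfolding Suc by (simp add: algebra_simps)
qed simp

lemma Dn_s_power: "(D ^^ n) (s ^ n) = fact n * \<alpha> ^ n"
proof (induction n)
  case (Suc n)
  have "(D ^^ Suc n) (s ^ Suc n) = (D ^^ n) (of_nat (Suc n) * \<alpha> * s ^ n)"
    by (simp only: funpow_Suc_right o_apply D_s_power)
  also have "\<dots> = of_nat (Suc n) * \<alpha> * (D ^^ n) (s ^ n)"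
    by (rule Dn_A_mult) (intro A_mult A_of_nat \<alpha>_A B_power s_B)+
  finally show ?case by (simp add: Suc algebra_simps)
qed simp

lemma D_poly:
  assumes "\<And>j. coeff p j \<in> A"
  shows "D (poly p s) = poly (pderiv p) s * \<alpha>"
  using assms
proof (induction p)
  case (pCons a p)
  have a: "a \<in> A" using pCons.prems[of 0] by simp
  have p: "coeff p j \<in> A" for j using pCons.prems[of "Suc j"] by simp
  have B: "poly p s \<in> B" by (intro poly_in_B s_B A_B p)
  have "D (poly (pCons a p) s) = D a + D (s * poly p s)"
    using a B by (simp add: D_add A_B B_mult s_B)
  also have "\<dots> = s * (poly (pderiv p) s * \<alpha>) + \<alpha> * poly p s"
    using a B pCons.IH[OF p] by (simp add: A_def D_mult s_B)
  finally show ?case by (simp add: pderiv_pCons algebra_simps)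
qed simp

text \<open>On \<open>A[s]\<close> the derivation is \<open>\<alpha>\<close> times formal
  differentiation, so a relation for \<open>s\<close> yields one of smaller degree; in
  characteristic zero the derivative of a nonconstant polynomial is nonzero.\<close>

lemma s_transcendental:
  assumes "\<And>j. coeff p j \<in> A" "poly p s = 0"
  shows "p = 0"
  using assms
proof (induction "degree p" arbitrary: p)
  case 0
  then obtain c where "p = [:c:]" using degree_eq_zeroE by metis
  then show ?case using 0 by simp
next
  case (Suc n)
  have "poly (pderiv p) s = 0"
    using D_poly[of p] Suc.prems Ds by simp
  moreover have "coeff (pderiv p) j \<in> A" for j
    unfolding coeff_pderiv by (intro A_mult A_of_nat Suc.prems)
  moreover have "degree (pderiv p) = n"
    using Suc.hyps(2) by (simp add: degree_pderiv)
  ultimately have "pderiv p = 0" using Suc.hyps(1) by blast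
  then show ?case using Suc.hyps(2) by (simp add: pderiv_eq_0_iff)
qed

text \<open>The kernel of a locally nilpotent derivation is factorially closed; here only
  the divisor \<^term>\<open>s\<close> is needed.\<close>

lemma s_not_dvd_kernel:
  assumes "w \<in> B" "s * w \<in> A" "s * w \<noteq> 0"
  shows False
proof -
  have "w \<noteq> 0" using assms(3) by auto
  then obtain r where r: "(D ^^ r) w \<noteq> 0" "(D ^^ Suc r) w = 0"
    using last_nonzero assms(1) by blast
  \<comment> \<open>The iterated Leibniz rule has only two terms because \<open>D (D s) = 0\<close>.
    For \<open>k = r\<close> the left side vanishes since \<open>s * w\<close> is in the kernel, and
    the first term on the right by the choice of \<open>r\<close>; what remains is a product of
    nonzero factors.\<close>
  have L: "(D ^^ Suc k) (s * w) = s * (D ^^ Suc k) w + of_nat (Suc k) * \<alpha> * (D ^^ k) w" for k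
  proof (induction k)
    case 0
    show ?case using D_mult[OF s_B assms(1)] by simp
  next
    case (Suc k)
    have B: "(D ^^ k) w \<in> B" "(D ^^ Suc k) w \<in> B" using assms(1) Dn_B by blast+
    have "(D ^^ Suc (Suc k)) (s * w) = D (s * (D ^^ Suc k) w + (of_nat (Suc k) * \<alpha>) * (D ^^ k) w)"
      using Suc by simp
    also have "\<dots> = D (s * (D ^^ Suc k) w) + D ((of_nat (Suc k) * \<alpha>) * (D ^^ k) w)"
      by (intro D_add B_mult s_B B B_of_nat A_B[OF \<alpha>_A])
    also have "D (s * (D ^^ Suc k) w) = s * (D ^^ Suc (Suc k)) w + \<alpha> * (D ^^ Suc k) w"
      using D_mult[OF s_B B(2)] by simp
    also have "D ((of_nat (Suc k) * \<alpha>) * (D ^^ k) w) = (of_nat (Suc k) * \<alpha>) * D ((D ^^ k) w)"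
      by (intro D_A_mult A_mult A_of_nat \<alpha>_A B)
    also have "D ((D ^^ k) w) = (D ^^ Suc k) w" by simp
    finally show ?case by (simp add: algebra_simps)
  qed
  have "(D ^^ Suc r) (s * w) = (D ^^ r) (D (s * w))"
    by (simp only: funpow_Suc_right o_apply)
  also have "\<dots> = 0" using assms(2) by (simp add: A_def)
  finally have "of_nat (Suc r) * \<alpha> * (D ^^ r) w = 0"
    using L[of r] r(2) by simp
  then show False using Ds r(1) of_nat_neq_0 by (metis mult_eq_0_iff)
qed

end

section \<open>Homogeneous slices and the degrees of the kernel\<close>

locale homogeneous_slice = local_slice +
  fixes e ds :: int
  assumes D_G: "x \<in> G d \<Longrightarrow> D x \<in> G (d + e)"
    and s_G: "s \<in> G ds"
begin

definition "d\<alpha> = ds + e"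

lemma \<alpha>_G: "\<alpha> \<in> G d\<alpha>"
  unfolding d\<alpha>_def by (rule D_G[OF s_G])

lemma Dn_G: "x \<in> G d \<Longrightarrow> (D ^^ n) x \<in> G (d + int n * e)"
proof (induction n)
  case (Suc n)
  then show ?case using D_G[of "(D ^^ n) x" "d + int n * e"] by (simp add: algebra_simps)
qed simp

text \<open>The inclusion of \<^term>\<open>B\<close> in \<open>A\<^sub>\<alpha>[s]\<close>.\<close>

lemma slice_expansion:
  assumes "x \<in> G d"
  shows "\<exists>M N p. M > 0 \<and> of_nat M * \<alpha> ^ N * x = poly p s \<and>
    (\<forall>j. coeff p j \<in> A \<inter> G (d + int N * d\<alpha> - int j * ds))"
proof -
  obtain n where "(D ^^ n) x = 0" using D_nilp G_B assms by blast
  then show ?thesis using assms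
  proof (induction n arbitrary: x d)
    case 0
    then show ?case by (intro exI[of _ 1] exI[of _ 0]) (simp add: A_0 G_0)
  next
    case (Suc n)
    define y where "y = (D ^^ n) x"
    have xB: "x \<in> B" using Suc.prems G_B by blast
    have yA: "y \<in> A" using Suc.prems by (simp add: A_def y_def Dn_B xB)
    have yG: "y \<in> G (d + int n * e)" unfolding y_def by (rule Dn_G) (rule Suc.prems)
    \<comment> \<open>The top term of the expansion is removed: \<open>D ^^ n\<close> sends
      \<open>s ^ n\<close> to \<open>fact n * \<alpha> ^ n\<close>, so both parts of the difference
      have the same image under it and \<open>D ^^ n\<close> kills \<open>x'\<close>. Both parts
      have degree \<open>d + int n * d\<alpha>\<close>.\<close>
    define x' where "x' = of_nat (fact n) * \<alpha> ^ n * x - s ^ n * y"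
    have "of_nat (fact n) * (\<alpha> ^ n * x) \<in> G (int n * d\<alpha> + d)"
      by (intro G_of_nat_mult G_mult G_power \<alpha>_G Suc.prems)
    moreover have "s ^ n * y \<in> G (int n * ds + (d + int n * e))"
      by (intro G_mult G_power s_G yG)
    ultimately have x'G: "x' \<in> G (d + int n * d\<alpha>)"
      unfolding x'_def using G_diff by (simp add: d\<alpha>_def algebra_simps)
    have "(D ^^ n) (x' + y * s ^ n) = (D ^^ n) x' + (D ^^ n) (y * s ^ n)"
      using x'G by (intro Dn_add B_mult B_power s_B A_B[OF yA]) (rule G_B)
    moreover have "(D ^^ n) (y * s ^ n) = y * (fact n * \<alpha> ^ n)"
      using Dn_A_mult[OF yA B_power[OF s_B], of n n] by (simp add: Dn_s_power)
    moreover have "(D ^^ n) (x' + y * s ^ n) = (D ^^ n) ((of_nat (fact n) * \<alpha> ^ n) * x)"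
      by (simp add: x'_def mult.commute)
    moreover have "\<dots> = (of_nat (fact n) * \<alpha> ^ n) * y"
      unfolding y_def by (intro Dn_A_mult A_mult A_of_nat A_power \<alpha>_A xB)
    ultimately have "(D ^^ n) x' = 0" by (simp add: algebra_simps)
    then obtain M N p where IH: "M > 0" "of_nat M * \<alpha> ^ N * x' = poly p s"
      "\<And>j. coeff p j \<in> A" "\<And>j. coeff p j \<in> G (d + int n * d\<alpha> + int N * d\<alpha> - int j * ds)"
      using Suc.IH[OF _ x'G] by auto
    \<comment> \<open>The coefficient of \<open>s ^ n\<close> in the expansion of \<open>x\<close>:
      it is \<open>y\<close> times the factor that was needed to expand \<open>x'\<close>.\<close>
    define z where "z = of_nat M * (\<alpha> ^ N * y)"
    have zA: "z \<in> A" unfolding z_def by (intro A_mult A_of_nat A_power \<alpha>_A yA)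
    have "z \<in> G (int N * d\<alpha> + (d + int n * e))"
      unfolding z_def by (intro G_mult G_of_nat_mult G_power \<alpha>_G yG)
    then have zG: "z \<in> G (d + int (N + n) * d\<alpha> - int n * ds)"
      by (simp add: d\<alpha>_def algebra_simps)
    have "of_nat (M * fact n) * \<alpha> ^ (N + n) * x = poly (p + monom z n) s"
    proof -
      have "of_nat (M * fact n) * \<alpha> ^ (N + n) * x = of_nat M * \<alpha> ^ N * x' + z * s ^ n"
        by (simp add: x'_def z_def algebra_simps power_add)
      then show ?thesis by (simp add: IH poly_monom)
    qed
    moreover have "coeff (p + monom z n) j \<in> A \<inter> G (d + int (N + n) * d\<alpha> - int j * ds)" for j
      using A_add[OF IH(3)[of j] zA] IH(3)[of j] IH(4)[of j] zG
      by (auto simp: algebra_simps intro!: G_add)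
    moreover have "M * fact n > 0" using IH(1) by simp
    ultimately show ?case by blast
  qed
qed

definition kdegs :: "int set" where
  "kdegs = {d. \<exists>x\<in>A \<inter> G d. x \<noteq> 0}"

lemma kdegs_\<alpha>: "d\<alpha> \<in> kdegs"
  unfolding kdegs_def using \<alpha>_A \<alpha>_G Ds by blast

text \<open>The constant term is a nonzero kernel element of degree
  \<open>d + int N * d\<alpha>\<close>, and \<open>d\<alpha>\<close> is itself a degree of the
  kernel, so its multiple can be subtracted.\<close>

lemma degree_in_kdegs:
  assumes "x \<in> G d" "of_nat M * \<alpha> ^ N * x = poly p s" "coeff p 0 \<noteq> 0"
    "\<And>j. coeff p j \<in> A \<inter> G (d + int N * d\<alpha> - int j * ds)"
  shows "d \<in> zspan kdegs"
proof -
  have "d + int N * d\<alpha> \<in> kdegs"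
    unfolding kdegs_def using assms(3) assms(4)[of 0] by auto
  then have "(d + int N * d\<alpha>) + (- int N) * d\<alpha> \<in> zspan kdegs"
    by (intro zspan_sum zspan_mult zspan_base kdegs_\<alpha>)
  then show ?thesis by simp
qed

text \<open>At most one of two coprime homogeneous elements lies in the prime ideal \<open>s A\<^sub>\<alpha>[s] \<inter> B\<close>.\<close>

lemma one_degree_in_kdegs:
  assumes "x1 \<in> G d1" "x2 \<in> G d2" "x1 \<noteq> 0"
    and cop: "\<And>u v. u \<in> B \<Longrightarrow> v \<in> B \<Longrightarrow> x1 * v = x2 * u \<Longrightarrow> \<exists>w\<in>B. u = x1 * w"
  shows "d1 \<in> zspan kdegs \<or> d2 \<in> zspan kdegs"
proof (rule ccontr)
  assume neg: "\<not> ?thesis"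
  obtain M1 N1 p1 where 1: "M1 > 0" "of_nat M1 * \<alpha> ^ N1 * x1 = poly p1 s"
    "\<And>j. coeff p1 j \<in> A \<inter> G (d1 + int N1 * d\<alpha> - int j * ds)"
    using slice_expansion[OF assms(1)] by blast
  obtain M2 N2 p2 where 2: "M2 > 0" "of_nat M2 * \<alpha> ^ N2 * x2 = poly p2 s"
    "\<And>j. coeff p2 j \<in> A \<inter> G (d2 + int N2 * d\<alpha> - int j * ds)"
    using slice_expansion[OF assms(2)] by blast
  \<comment> \<open>Neither degree lies in the group, so both constant terms vanish and both
    expansions are divisible by \<open>s\<close>.\<close>
  have z: "coeff p1 0 = 0" "coeff p2 0 = 0"
    using degree_in_kdegs[OF assms(1) 1(2)] degree_in_kdegs[OF assms(2) 2(2)] 1(3) 2(3) neg by blast+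
  obtain q1 where q1: "p1 = pCons 0 q1" using z(1) by (cases p1) auto
  obtain q2 where q2: "p2 = pCons 0 q2" using z(2) by (cases p2) auto
  define u1 u2 where "u1 = poly q1 s" and "u2 = poly q2 s"
  have u1: "u1 \<in> B" unfolding u1_def
    using 1(3)[of "Suc _"] by (intro poly_in_B s_B A_B) (simp add: q1)
  have u2: "u2 \<in> B" unfolding u2_def
    using 2(3)[of "Suc _"] by (intro poly_in_B s_B A_B) (simp add: q2)
  define b1 b2 where "b1 = of_nat M1 * \<alpha> ^ N1" and "b2 = of_nat M2 * \<alpha> ^ N2"
  have b: "b1 \<in> A" "b2 \<in> A" unfolding b1_def b2_def by (intro A_mult A_of_nat A_power \<alpha>_A)+
  have b0: "b1 \<noteq> 0" "b2 \<noteq> 0" using 1(1) 2(1) Ds by (auto simp: b1_def b2_def)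
  have e1: "b1 * x1 = s * u1" using 1(2) by (simp add: b1_def u1_def q1)
  have e2: "b2 * x2 = s * u2" using 2(2) by (simp add: b2_def u2_def q2)
  have s0: "s \<noteq> 0" using Ds by auto
  have "s * (x1 * (b1 * u2)) = s * (x2 * (b2 * u1))"
  proof -
    have "s * (x1 * (b1 * u2)) = (b1 * x1) * (s * u2)" by (simp add: mult_ac)
    also have "\<dots> = (s * u1) * (b2 * x2)" by (simp only: e1 e2)
    finally show ?thesis by (simp add: mult_ac)
  qed
  then have "x1 * (b1 * u2) = x2 * (b2 * u1)" using s0 by simp
  \<comment> \<open>Coprimality makes \<open>b2 * u1\<close> a multiple of \<open>x1\<close>.
    Cancelling \<open>x1\<close> will give \<open>b1 * b2 = s * w\<close>, a nonzero kernel element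
    divisible by \<open>s\<close>.\<close>
  then obtain w where w: "w \<in> B" "b2 * u1 = x1 * w"
    using cop[of "b2 * u1" "b1 * u2"] B_mult u1 u2 b A_B by blast
  have "x1 * (b1 * b2) = b2 * (b1 * x1)" by (simp add: mult_ac)
  also have "\<dots> = s * (b2 * u1)" by (simp add: e1 mult_ac)
  also have "\<dots> = x1 * (s * w)" by (simp add: w(2) mult_ac)
  finally have "b1 * b2 = s * w" using assms(3) by simp
  then show False
    using s_not_dvd_kernel[of w] w(1) A_mult[OF b] b0 by (metis mult_eq_0_iff)
qed

end

section \<open>Homogeneous fractions of the ring and of the kernel\<close>

context graded_domain
begin

text \<open>The function field of Proj, realised inside the ambient field.\<close>

definition "hfrac = {x / y | x y d. x \<in> G d \<and> y \<in> G d \<and> y \<noteq> 0}"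

lemma hfracI: "x \<in> G d \<Longrightarrow> y \<in> G d \<Longrightarrow> y \<noteq> 0 \<Longrightarrow> x / y \<in> hfrac"
  unfolding hfrac_def by blast

end

context homogeneous_slice
begin

text \<open>Degree 0 gives the field over which the function field will be purely transcendental;
  the other degrees serve to shift homogeneous elements to degree 0.\<close>

definition kfrac :: "int \<Rightarrow> 'a set" where
  "kfrac d = {p / q | p q j. p \<in> A \<inter> G (d + j) \<and> q \<in> A \<inter> G j \<and> q \<noteq> 0}"

lemma kfracI: "p \<in> A \<Longrightarrow> p \<in> G (d + j) \<Longrightarrow> q \<in> A \<Longrightarrow> q \<in> G j \<Longrightarrow> q \<noteq> 0 \<Longrightarrow> p / q \<in> kfrac d"
  unfolding kfrac_def by blast

lemma kfracE:
  assumes "x \<in> kfrac d"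
  obtains p q j where "x = p / q" "p \<in> A" "p \<in> G (d + j)" "q \<in> A" "q \<in> G j" "q \<noteq> 0"
  using assms unfolding kfrac_def by blast

lemma kfrac_A: "x \<in> A \<Longrightarrow> x \<in> G d \<Longrightarrow> x \<in> kfrac d"
  using kfracI[of x d 0 1] by (simp add: A_1 G_1)

lemma kfrac_0: "0 \<in> kfrac d" by (intro kfrac_A A_0 G_0)

lemma kfrac_1: "1 \<in> kfrac 0" by (intro kfrac_A A_1 G_1)

lemma kfrac_mult:
  assumes "x \<in> kfrac d" "y \<in> kfrac d'"
  shows "x * y \<in> kfrac (d + d')"
proof -
  obtain p q j where 1: "x = p / q" "p \<in> A" "p \<in> G (d + j)" "q \<in> A" "q \<in> G j" "q \<noteq> 0"
    using assms(1) by (rule kfracE)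
  obtain p' q' j' where 2: "y = p' / q'" "p' \<in> A" "p' \<in> G (d' + j')" "q' \<in> A" "q' \<in> G j'" "q' \<noteq> 0"
    using assms(2) by (rule kfracE)
  have "(p * p') / (q * q') \<in> kfrac (d + d')"
  proof (rule kfracI[where j = "j + j'"])
    show "p * p' \<in> G (d + d' + (j + j'))"
      using G_mult[OF 1(3) 2(3)] by (simp add: algebra_simps)
  qed (use 1 2 in \<open>auto intro: A_mult G_mult\<close>)
  then show ?thesis by (simp add: 1 2)
qed

lemma A_uminus: "x \<in> A \<Longrightarrow> - x \<in> A"
proof -
  assume x: "x \<in> A"
  have m: "- 1 \<in> B" using G_uminus[OF G_1] G_B by blast
  have "D (1 + (- 1)) = D 1 + D (- 1)" by (rule D_add[OF B_1 m])
  then have "- 1 \<in> A" using m by (simp add: A_def)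
  then show ?thesis using A_mult[OF _ x] by fastforce
qed

lemma kfrac_uminus:
  assumes "x \<in> kfrac d"
  shows "- x \<in> kfrac d"
proof -
  obtain p q j where 1: "x = p / q" "p \<in> A" "p \<in> G (d + j)" "q \<in> A" "q \<in> G j" "q \<noteq> 0"
    using assms by (rule kfracE)
  have "(- p) / q \<in> kfrac d" using 1 by (intro kfracI A_uminus G_uminus)
  then show ?thesis by (simp add: 1)
qed

lemma kfrac_add:
  assumes "x \<in> kfrac d" "y \<in> kfrac d"
  shows "x + y \<in> kfrac d"
proof -
  obtain p q j where 1: "x = p / q" "p \<in> A" "p \<in> G (d + j)" "q \<in> A" "q \<in> G j" "q \<noteq> 0"
    using assms(1) by (rule kfracE)
  obtain p' q' j' where 2: "y = p' / q'" "p' \<in> A" "p' \<in> G (d + j')" "q' \<in> A" "q' \<in> G j'" "q' \<noteq> 0"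
    using assms(2) by (rule kfracE)
  have "p * q' \<in> G (d + (j + j'))" "p' * q \<in> G (d + (j + j'))"
    using G_mult[of p "d + j" q' j'] G_mult[of p' "d + j'" q j] 1 2 by (auto simp: algebra_simps)
  then have "(p * q' + p' * q) / (q * q') \<in> kfrac d"
    using 1 2 by (intro kfracI[where j = "j + j'"] G_add) (auto intro: A_mult A_add G_mult)
  then show ?thesis using 1(6) 2(6) by (simp add: 1 2 add_frac_eq)
qed

lemma kfrac_inverse:
  assumes "x \<in> kfrac d"
  shows "inverse x \<in> kfrac (- d)"
proof (cases "x = 0")
  case False
  obtain p q j where 1: "x = p / q" "p \<in> A" "p \<in> G (d + j)" "q \<in> A" "q \<in> G j" "q \<noteq> 0"
    using assms by (rule kfracE)
  have "q / p \<in> kfrac (- d)"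
    by (rule kfracI[where j = "d + j"]) (use 1 False in auto)
  then show ?thesis by (simp add: 1)
qed (simp add: kfrac_0)

lemma kfrac_power: "x \<in> kfrac d \<Longrightarrow> x ^ n \<in> kfrac (int n * d)"
proof (induction n)
  case (Suc n)
  then show ?case using kfrac_mult[of x d "x ^ n" "int n * d"] by (simp add: algebra_simps)
qed (simp add: kfrac_1)

lemma kfrac_0_hfrac: "x \<in> kfrac 0 \<Longrightarrow> x \<in> hfrac"
  unfolding hfrac_def kfrac_def by auto

text \<open>A generator of the group is the degree of a nonzero kernel element; adding or
  subtracting it corresponds to multiplying or dividing by that element.\<close>

lemma kfrac_nonzero:
  assumes "d \<in> zspan kdegs"
  shows "\<exists>x\<in>kfrac d. x \<noteq> 0"
  using assms
proof (induction d rule: zspan.induct)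
  case zero
  show ?case by (rule bexI[OF _ kfrac_1]) simp
next
  case (plus g d)
  then obtain x y where "x \<in> kfrac d" "x \<noteq> 0" "y \<in> A" "y \<in> G g" "y \<noteq> 0"
    unfolding kdegs_def by auto
  then have "x * y \<in> kfrac (d + g)" "x * y \<noteq> 0" by (auto intro: kfrac_mult kfrac_A)
  then show ?case by blast
next
  case (minus g d)
  then obtain x y where "x \<in> kfrac d" "x \<noteq> 0" "y \<in> A" "y \<in> G g" "y \<noteq> 0"
    unfolding kdegs_def by auto
  then have "x * inverse y \<in> kfrac (d + - g)" "x * inverse y \<noteq> 0"
    using kfrac_mult[OF _ kfrac_inverse[OF kfrac_A]] by auto
  then show ?case by (metis diff_conv_add_uminus)
qed

lemma t_in_hfrac:
  assumes "\<theta> \<in> kfrac (- ds)"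
  shows "s * \<theta> \<in> hfrac"
proof -
  obtain p q j where 1: "\<theta> = p / q" "p \<in> A" "p \<in> G (- ds + j)" "q \<in> A" "q \<in> G j" "q \<noteq> 0"
    using assms by (rule kfracE)
  have "s * p \<in> G j" using G_mult[OF s_G 1(3)] by simp
  then show ?thesis using hfracI[of "s * p" j q] 1 by simp
qed

text \<open>Clearing the denominators of the coefficients and of \<open>\<theta>\<close> turns a
  relation for \<open>s * \<theta>\<close> into one for \<open>s\<close> over \<open>A\<close>,
  where \<open>s\<close> is transcendental.\<close>

lemma t_transcendental:
  assumes \<theta>: "\<theta> \<in> kfrac (- ds)" "\<theta> \<noteq> 0"
    and P: "\<And>j. coeff P j \<in> kfrac 0" "poly P (s * \<theta>) = 0"
  shows "P = 0"
proof -
  obtain b1 b2 where b: "\<theta> = b1 / b2" "b1 \<in> A" "b2 \<in> A" "b2 \<noteq> 0"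
    using \<theta>(1) by (rule kfracE)
  have "b1 \<noteq> 0" using b \<theta> by auto
  have "\<exists>q. q \<in> A \<and> q \<noteq> 0 \<and> q * coeff P j \<in> A" for j
  proof -
    obtain p q where "coeff P j = p / q" "p \<in> A" "q \<in> A" "q \<noteq> 0"
      using P(1)[of j] by (rule kfracE)
    then show ?thesis by (intro exI[of _ q]) simp
  qed
  then obtain q where q: "\<And>j. q j \<in> A" "\<And>j. q j \<noteq> 0" "\<And>j. q j * coeff P j \<in> A" by metis
  define n where "n = degree P"
  define Q where "Q = (\<Prod>j\<le>n. q j)"
  have Q0: "Q \<noteq> 0" by (simp add: Q_def q)
  have QA: "Q * coeff P j \<in> A" if "j \<le> n" for j
  proof -
    have "Q * coeff P j = (\<Prod>i\<in>{..n} - {j}. q i) * (q j * coeff P j)"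
      using that by (simp add: Q_def prod.remove[of "{..n}" j] mult_ac)
    then show ?thesis using A_mult[OF A_prod q(3), of "{..n} - {j}" q j] q(1) by metis
  qed
  \<comment> \<open>As \<open>\<theta> = b1 / b2\<close>, the value of \<open>R\<close> at
    \<open>s\<close> is \<open>Q * b2 ^ n\<close> times the value of \<open>P\<close> at
    \<open>s * \<theta>\<close>; the factor \<open>b2 ^ (n - j)\<close> keeps the coefficients in
    \<open>A\<close>.\<close>
  define R where "R = (\<Sum>j\<le>n. monom (Q * coeff P j * b1 ^ j * b2 ^ (n - j)) j)"
  have cR: "coeff R j = (if j \<le> n then Q * coeff P j * b1 ^ j * b2 ^ (n - j) else 0)" for j
    by (simp add: R_def coeff_sum)
  have "coeff R j \<in> A" for j
    unfolding cR using A_mult[OF A_mult[OF QA A_power[OF b(2)]] A_power[OF b(3)]] A_0 by simp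
  moreover have "poly R s = 0"
  proof -
    have "poly R s = (\<Sum>j\<le>n. Q * b2 ^ n * (coeff P j * (s * \<theta>) ^ j))"
      unfolding R_def poly_sum poly_monom
      by (rule sum.cong) (use b(4) in \<open>auto simp: b(1) power_mult_distrib power_divide power_diff\<close>)
    also have "\<dots> = Q * b2 ^ n * poly P (s * \<theta>)"
      by (simp add: poly_altdef n_def sum_distrib_left)
    finally show ?thesis using P(2) by simp
  qed
  ultimately have "R = 0" by (rule s_transcendental)
  then have "coeff P j = 0" if "j \<le> n" for j
    using cR[of j] that Q0 \<open>b1 \<noteq> 0\<close> b(4) by simp
  then show ?thesis by (metis leading_coeff_0_iff n_def order_refl)
qed

text \<open>Numerator and denominator are divided by one \<open>\<mu>\<close> of their common
  degree. Each quotient is a polynomial in \<open>s * \<theta>\<close> with coefficients in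
  \<open>kfrac 0\<close>, so both lie in \<open>R\<close>.\<close>

lemma hfrac_generated:
  assumes \<theta>: "\<theta> \<in> kfrac (- ds)" "\<theta> \<noteq> 0" and deg: "\<And>d. d \<in> zspan kdegs"
    and R: "kfrac 0 \<subseteq> R" "s * \<theta> \<in> R"
      "\<And>x y. x \<in> R \<Longrightarrow> y \<in> R \<Longrightarrow> x + y \<in> R" "\<And>x y. x \<in> R \<Longrightarrow> y \<in> R \<Longrightarrow> x * y \<in> R"
      "\<And>x. x \<in> R \<Longrightarrow> x \<noteq> 0 \<Longrightarrow> inverse x \<in> R"
  shows "hfrac \<subseteq> R"
proof
  fix z assume "z \<in> hfrac"
  then obtain x y d where z: "z = x / y" "x \<in> G d" "y \<in> G d" "y \<noteq> 0"
    unfolding hfrac_def by blast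
  obtain \<mu> where \<mu>: "\<mu> \<in> kfrac d" "\<mu> \<noteq> 0" using kfrac_nonzero[OF deg] by blast
  have R0: "0 \<in> R" using R(1) kfrac_0 by blast
  have R1: "1 \<in> R" using R(1) kfrac_1 by blast
  have Rsum: "(\<Sum>i\<in>I. h i) \<in> R" if "\<And>i. i \<in> I \<Longrightarrow> h i \<in> R" for h and I :: "nat set"
    using that by (induction I rule: infinite_finite_induct) (auto intro: R R0)
  have Rpow: "(s * \<theta>) ^ n \<in> R" for n by (induction n) (auto intro: R R1)
  have main: "x / \<mu> \<in> R" if x: "x \<in> G d" for x
  proof -
    obtain M N p where 1: "M > 0" "of_nat M * \<alpha> ^ N * x = poly p s"
      "\<And>j. coeff p j \<in> A \<inter> G (d + int N * d\<alpha> - int j * ds)"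
      using slice_expansion[OF x] by blast
    define m where "m = of_nat M * \<alpha> ^ N"
    have m0: "m \<noteq> 0" using 1 Ds by (simp add: m_def)
    have "of_nat M * \<alpha> ^ N \<in> G (int N * d\<alpha>)" by (intro G_of_nat_mult G_power \<alpha>_G)
    then have mK: "m \<in> kfrac (int N * d\<alpha>)"
      unfolding m_def by (intro kfrac_A A_mult A_of_nat A_power \<alpha>_A)
    \<comment> \<open>\<open>coeff p j\<close> has degree
      \<open>d + int N * d\<alpha> - int j * ds\<close>, while \<open>m\<close>,
      \<open>\<mu>\<close> and \<open>\<theta> ^ j\<close> have degrees
      \<open>int N * d\<alpha>\<close>, \<open>d\<close> and \<open>- int j * ds\<close>; so
      \<open>\<kappa> j\<close> has degree 0.\<close>
    define \<kappa> where "\<kappa> j = coeff p j * inverse (m * \<mu> * \<theta> ^ j)" for j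
    have "coeff p j * inverse (m * \<mu> * \<theta> ^ j) \<in>
        kfrac ((d + int N * d\<alpha> - int j * ds) + - (int N * d\<alpha> + d + int j * (- ds)))" for j
      using 1(3)[of j] by (intro kfrac_mult kfrac_inverse kfrac_power mK \<mu> \<theta> kfrac_A) auto
    then have \<kappa>: "\<kappa> j \<in> R" for j
      unfolding \<kappa>_def using R(1) by (auto simp: algebra_simps)
    have "x / \<mu> = (m * x) * inverse (m * \<mu>)" using m0 by (simp add: field_simps)
    also have "\<dots> = (\<Sum>j\<le>degree p. \<kappa> j * (s * \<theta>) ^ j)"
    proof -
      have "coeff p j * s ^ j * inverse (m * \<mu>) = \<kappa> j * (s * \<theta>) ^ j" for j
        using \<theta>(2) by (simp add: \<kappa>_def power_mult_distrib)
      then show ?thesis using 1(2) unfolding m_def[symmetric]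
        by (simp add: poly_altdef sum_distrib_right)
    qed
    also have "\<dots> \<in> R" by (intro Rsum R(4) \<kappa> Rpow)
    finally show ?thesis .
  qed
  have "x / \<mu> * inverse (y / \<mu>) \<in> R"
    by (intro R(4,5) main z) (use z(4) \<mu>(2) in auto)
  then show "z \<in> R" using \<mu> z by simp
qed

end

text \<open>The homomorphism \<^term>\<open>\<Lambda>\<close> sends \<open>\<Sum>\<^sub>d x\<^sub>d\<close> to \<open>\<Sum>\<^sub>d x\<^sub>d z\<^sup>d\<close>; its existence expresses that
  the sum of the graded pieces is direct.\<close>

locale nat_graded_domain = graded_domain +
  fixes \<Lambda>
  assumes \<Lambda>_add: "x \<in> B \<Longrightarrow> y \<in> B \<Longrightarrow> \<Lambda> (x + y) = \<Lambda> x + \<Lambda> y"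
    and \<Lambda>_mult: "x \<in> B \<Longrightarrow> y \<in> B \<Longrightarrow> \<Lambda> (x * y) = \<Lambda> x * \<Lambda> y"
    and \<Lambda>_G: "x \<in> G d \<Longrightarrow> \<Lambda> x = monom x (nat d)"
    and coeff_\<Lambda>: "x \<in> B \<Longrightarrow> coeff (\<Lambda> x) n \<in> G (int n)"
    and poly_\<Lambda>: "x \<in> B \<Longrightarrow> poly (\<Lambda> x) 1 = x"
    and G_neg: "x \<in> G d \<Longrightarrow> d < 0 \<Longrightarrow> x = 0"
begin

text \<open>The homogeneous component. Negative degrees form a case of their own because
  \<open>nat d\<close> would turn them into 0.\<close>

definition pr where "pr d x = (if d < 0 then 0 else coeff (\<Lambda> x) (nat d))"

lemma pr_G: "x \<in> B \<Longrightarrow> pr d x \<in> G d"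
  using coeff_\<Lambda>[of x "nat d"] by (auto simp: pr_def G_0)

lemma pr_B: "x \<in> B \<Longrightarrow> pr d x \<in> B"
  using pr_G G_B by blast

lemma pr_add: "x \<in> B \<Longrightarrow> y \<in> B \<Longrightarrow> pr d (x + y) = pr d x + pr d y"
  by (simp add: pr_def \<Lambda>_add)

lemma \<Lambda>_0: "\<Lambda> 0 = 0"
  using \<Lambda>_G[OF G_0[of 0]] by simp

lemma pr_0 [simp]: "pr d 0 = 0"
  by (simp add: pr_def \<Lambda>_0)

lemma pr_sum: "(\<And>i. i \<in> I \<Longrightarrow> h i \<in> B) \<Longrightarrow> pr d (\<Sum>i\<in>I. h i) = (\<Sum>i\<in>I. pr d (h i))"
  by (induction I rule: infinite_finite_induct) (auto simp: pr_add B_sum)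

lemma pr_homogeneous: "x \<in> G d \<Longrightarrow> pr d' x = (if d' = d then x else 0)"
  using G_neg[of x d] by (cases "d < 0") (auto simp: pr_def \<Lambda>_G)

lemma sum_pr:
  assumes "x \<in> B" "degree (\<Lambda> x) \<le> n"
  shows "x = (\<Sum>i\<le>n. pr (int i) x)"
proof -
  have "x = poly (\<Lambda> x) 1" using poly_\<Lambda> assms by simp
  also have "\<dots> = (\<Sum>i\<le>n. coeff (\<Lambda> x) i * 1 ^ i)"
    unfolding poly_altdef using assms(2)
    by (intro sum.mono_neutral_left) (auto simp: coeff_eq_0)
  finally show ?thesis by (simp add: pr_def)
qed

text \<open>The degree filtration, stated through components so that 0 lies in every step of it
  without a convention for its degree.\<close>

definition bounded_by where "bounded_by d x \<longleftrightarrow> (\<forall>i>d. pr i x = 0)"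

lemma bounded_by_add: "x \<in> B \<Longrightarrow> y \<in> B \<Longrightarrow> bounded_by d x \<Longrightarrow> bounded_by d y \<Longrightarrow> bounded_by d (x + y)"
  by (simp add: bounded_by_def pr_add)

lemma bounded_by_0: "bounded_by d 0"
  by (simp add: bounded_by_def)

lemma bounded_by_sum:
  "(\<And>i. i \<in> I \<Longrightarrow> h i \<in> B) \<Longrightarrow> (\<And>i. i \<in> I \<Longrightarrow> bounded_by d (h i)) \<Longrightarrow> bounded_by d (\<Sum>i\<in>I. h i)"
  by (auto simp: bounded_by_def pr_sum)

lemma pr_mult_G:
  assumes "x \<in> G d" "y \<in> B"
  shows "pr (d + d') (x * y) = x * pr d' y"
proof -
  have B: "x \<in> B" using assms G_B by blast
  have y: "y = (\<Sum>i\<le>degree (\<Lambda> y). pr (int i) y)" using sum_pr assms(2) by simp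
  have "pr (d + d') (x * y) = (\<Sum>i\<le>degree (\<Lambda> y). pr (d + d') (x * pr (int i) y))"
    by (subst y) (auto simp: sum_distrib_left B_mult B pr_B assms intro!: pr_sum)
  also have "\<dots> = (\<Sum>i\<le>degree (\<Lambda> y). x * pr d' (pr (int i) y))"
  proof (rule sum.cong)
    fix i
    have i: "pr (int i) y \<in> G (int i)" by (rule pr_G[OF assms(2)])
    show "pr (d + d') (x * pr (int i) y) = x * pr d' (pr (int i) y)"
      using pr_homogeneous[OF G_mult[OF assms(1) i], of "d + d'"] pr_homogeneous[OF i, of d'] by simp
  qed simp
  also have "\<dots> = x * pr d' (\<Sum>i\<le>degree (\<Lambda> y). pr (int i) y)"
    by (simp add: sum_distrib_left[symmetric] pr_sum pr_B assms)
  finally show ?thesis using y by simp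
qed

lemma bounded_by_mult_G: "x \<in> G d \<Longrightarrow> y \<in> B \<Longrightarrow> bounded_by d' y \<Longrightarrow> bounded_by (d + d') (x * y)"
  unfolding bounded_by_def using pr_mult_G[of x d y] by (metis add.commute add_diff_cancel_left' diff_add_cancel less_diff_eq mult_zero_right)

end

section \<open>The leading homogeneous component of a derivation\<close>

locale filtered_lnd = nat_graded_domain + lnd +
  fixes e :: int
  assumes D_bounded: "x \<in> G d \<Longrightarrow> bounded_by (d + e) (D x)"
begin

text \<open>\<open>D\<close> maps degree \<open>d\<close> into degrees at most \<open>d + e\<close>;
  only the part of degree exactly \<open>d + e\<close> is kept. This is the derivation induced on
  the associated graded ring.\<close>

definition Dtop where
  "Dtop x = (\<Sum>i\<le>degree (\<Lambda> x). pr (int i + e) (D (pr (int i) x)))"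

text \<open>Allows two elements and their sum to be compared over a common range of degrees.\<close>

lemma Dtop_eq:
  assumes "x \<in> B" "degree (\<Lambda> x) \<le> n"
  shows "Dtop x = (\<Sum>i\<le>n. pr (int i + e) (D (pr (int i) x)))"
  unfolding Dtop_def
proof (rule sum.mono_neutral_left)
  show "\<forall>i\<in>{..n} - {..degree (\<Lambda> x)}. pr (int i + e) (D (pr (int i) x)) = 0"
    using assms by (auto simp: pr_def[of _ x] coeff_eq_0)
qed (use assms in auto)

lemma Dtop_B: "x \<in> B \<Longrightarrow> Dtop x \<in> B"
  unfolding Dtop_def by (intro B_sum pr_B D_B)

lemma Dtop_add:
  assumes "x \<in> B" "y \<in> B"
  shows "Dtop (x + y) = Dtop x + Dtop y"
proof -
  define n where "n = max (degree (\<Lambda> x)) (degree (\<Lambda> y))"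
  have "degree (\<Lambda> (x + y)) \<le> n"
    unfolding n_def \<Lambda>_add[OF assms] by (rule degree_add_le_max)
  then show ?thesis
    using assms Dtop_eq[of "x + y" n] Dtop_eq[of x n] Dtop_eq[of y n]
    by (simp add: n_def B_add pr_add D_add D_B pr_B sum.distrib)
qed

lemma Dtop_sum: "(\<And>i. i \<in> I \<Longrightarrow> h i \<in> B) \<Longrightarrow> Dtop (\<Sum>i\<in>I. h i) = (\<Sum>i\<in>I. Dtop (h i))"
proof (induction I rule: infinite_finite_induct)
  case (insert x F)
  then show ?case by (simp add: Dtop_add B_sum)
qed (simp_all add: Dtop_def \<Lambda>_0)

lemma Dtop_homogeneous:
  assumes "x \<in> G d"
  shows "Dtop x = pr (d + e) (D x)"
proof (cases "d < 0")
  case True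
  then show ?thesis using G_neg[OF assms] by (simp add: Dtop_def \<Lambda>_0)
next
  case False
  have B: "x \<in> B" using assms G_B by blast
  have "degree (\<Lambda> x) \<le> nat d"
    using \<Lambda>_G[OF assms] by (simp add: degree_monom_le)
  then have "Dtop x = (\<Sum>i\<le>nat d. pr (int i + e) (D (pr (int i) x)))"
    by (rule Dtop_eq[OF B])
  also have "\<dots> = (\<Sum>i\<le>nat d. if i = nat d then pr (d + e) (D x) else 0)"
    by (rule sum.cong) (use False in \<open>auto simp: pr_homogeneous[OF assms]\<close>)
  finally show ?thesis by simp
qed

lemma Dtop_G: "x \<in> G d \<Longrightarrow> Dtop x \<in> G (d + e)"
  using Dtop_homogeneous[of x d] pr_G[OF D_B[OF G_B], of x d "d + e"] by simp

text \<open>On homogeneous factors this is the component of degree \<open>i + j + e\<close> of the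
  Leibniz rule for \<open>D\<close>; both sides are additive in each factor.\<close>

lemma Dtop_mult:
  assumes "x \<in> B" "y \<in> B"
  shows "Dtop (x * y) = x * Dtop y + Dtop x * y"
proof -
  have hom: "Dtop (u * v) = u * Dtop v + Dtop u * v" if u: "u \<in> G i" and v: "v \<in> G j" for u v i j
  proof -
    have B: "u \<in> B" "v \<in> B" using u v G_B by blast+
    have "Dtop (u * v) = pr (i + j + e) (D (u * v))"
      by (rule Dtop_homogeneous[OF G_mult[OF u v]])
    also have "\<dots> = pr (i + (j + e)) (u * D v) + pr (j + (i + e)) (v * D u)"
      using B by (simp add: D_mult pr_add B_mult D_B ac_simps)
    also have "\<dots> = u * pr (j + e) (D v) + v * pr (i + e) (D u)"
      using pr_mult_G[OF u D_B[OF B(2)]] pr_mult_G[OF v D_B[OF B(1)]] by simp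
    finally show ?thesis using Dtop_homogeneous[OF u] Dtop_homogeneous[OF v] by simp
  qed
  define n m where "n = degree (\<Lambda> x)" and "m = degree (\<Lambda> y)"
  have x: "x = (\<Sum>i\<le>n. pr (int i) x)" and y: "y = (\<Sum>i\<le>m. pr (int i) y)"
    using sum_pr assms by (simp_all add: n_def m_def)
  have B: "pr (int i) x \<in> B" "pr (int i) y \<in> B" for i using pr_B assms by blast+
  have "x * y = (\<Sum>i\<le>n. \<Sum>j\<le>m. pr (int i) x * pr (int j) y)"
    by (subst x, subst y) (rule sum_product)
  then have "Dtop (x * y) = (\<Sum>i\<le>n. \<Sum>j\<le>m. Dtop (pr (int i) x * pr (int j) y))"
    by (simp add: Dtop_sum B_sum B_mult B)
  also have "\<dots> = (\<Sum>i\<le>n. \<Sum>j\<le>m. pr (int i) x * Dtop (pr (int j) y) + Dtop (pr (int i) x) * pr (int j) y)"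
    by (intro sum.cong refl hom) (rule pr_G, rule assms)+
  also have "\<dots> = (\<Sum>i\<le>n. pr (int i) x) * (\<Sum>j\<le>m. Dtop (pr (int j) y)) + (\<Sum>i\<le>n. Dtop (pr (int i) x)) * (\<Sum>j\<le>m. pr (int j) y)"
    by (simp add: sum_product sum.distrib)
  also have "(\<Sum>j\<le>m. Dtop (pr (int j) y)) = Dtop y"
    by (subst (2) y) (simp add: Dtop_sum B)
  also have "(\<Sum>j\<le>n. Dtop (pr (int j) x)) = Dtop x"
    by (subst (2) x) (simp add: Dtop_sum B)
  finally show ?thesis using x y by simp
qed

text \<open>Components of degree below \<open>d\<close> cannot reach degree \<open>d + e\<close>, so
  the top part of \<open>D x\<close> depends only on the top part of \<open>x\<close>.\<close>

lemma D_bounded_by: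
  assumes "x \<in> B" "bounded_by d x"
  shows "bounded_by (d + e) (D x) \<and> pr (d + e) (D x) = pr (d + e) (D (pr d x))"
proof -
  define n where "n = degree (\<Lambda> x)"
  have "x = (\<Sum>i\<le>n. pr (int i) x)" using sum_pr assms by (simp add: n_def)
  then have Dx: "D x = (\<Sum>i\<le>n. D (pr (int i) x))"
    using D_sum[of "{..n}" "\<lambda>i. pr (int i) x"] pr_B assms(1) by simp
  have b: "bounded_by (int i + e) (D (pr (int i) x))" for i
    by (rule D_bounded) (rule pr_G[OF assms(1)])
  have DB: "D (pr i x) \<in> B" for i using D_B pr_B assms(1) by blast
  have "pr j (D (pr (int i) x)) = 0" if "j > d + e \<or> (j = d + e \<and> int i \<noteq> d)" for i j
  proof (cases "int i > d")
    case True
    then show ?thesis using assms(2) by (simp add: bounded_by_def)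
  next
    case False
    then show ?thesis using b[of i] that by (auto simp: bounded_by_def)
  qed
  note z = this
  have "bounded_by (d + e) (D x)"
    using z by (simp add: bounded_by_def Dx pr_sum DB)
  moreover have "pr (d + e) (D x) = (\<Sum>i\<le>n. pr (d + e) (D (pr (int i) x)))"
    by (simp add: Dx pr_sum DB)
  moreover have "\<dots> = pr (d + e) (D (pr d x))"
  proof (cases "0 \<le> d \<and> nat d \<le> n")
    case True
    then have "(\<Sum>i\<le>n. pr (d + e) (D (pr (int i) x))) = (\<Sum>i\<le>n. if i = nat d then pr (d + e) (D (pr d x)) else 0)"
      by (intro sum.cong) (auto simp: z)
    then show ?thesis using True by simp
  next
    case False
    then have "pr d x = 0" by (auto simp: pr_def n_def coeff_eq_0)
    moreover have "(\<Sum>i\<le>n. pr (d + e) (D (pr (int i) x))) = 0"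
      by (rule sum.neutral) (use False z in auto)
    ultimately show ?thesis by simp
  qed
  ultimately show ?thesis by simp
qed

text \<open>Taking leading parts commutes with iteration, so \<open>Dtop\<close> inherits local
  nilpotency from \<open>D\<close>.\<close>

lemma Dtop_power_homogeneous:
  assumes "x \<in> G d"
  shows "(Dtop ^^ m) x = pr (d + int m * e) ((D ^^ m) x) \<and> bounded_by (d + int m * e) ((D ^^ m) x)"
proof (induction m)
  case 0
  then show ?case using assms pr_homogeneous[OF assms] by (simp add: bounded_by_def)
next
  case (Suc m)
  define y where "y = (D ^^ m) x"
  have y: "y \<in> B" unfolding y_def by (rule Dn_B) (rule G_B[OF assms])
  have "(Dtop ^^ Suc m) x = Dtop (pr (d + int m * e) y)" using Suc by (simp add: y_def)
  also have "\<dots> = pr (d + int m * e + e) (D (pr (d + int m * e) y))"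
    by (rule Dtop_homogeneous[OF pr_G[OF y]])
  finally show ?case
    using D_bounded_by[OF y, of "d + int m * e"] Suc by (simp add: y_def algebra_simps)
qed

lemma Dtop_0 [simp]: "Dtop 0 = 0"
  by (simp add: Dtop_def \<Lambda>_0)

lemma Dtop_power_0 [simp]: "(Dtop ^^ m) 0 = 0"
  by (induction m) auto

lemma Dtop_power_B: "x \<in> B \<Longrightarrow> (Dtop ^^ m) x \<in> B"
  by (induction m) (auto intro: Dtop_B)

lemma Dtop_power_sum:
  "(\<And>i. i \<in> I \<Longrightarrow> h i \<in> B) \<Longrightarrow> (Dtop ^^ m) (\<Sum>i\<in>I. h i) = (\<Sum>i\<in>I. (Dtop ^^ m) (h i))"
  by (induction m) (auto simp: Dtop_sum Dtop_power_B)

lemma Dtop_nilp: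
  assumes "x \<in> B"
  shows "\<exists>m. (Dtop ^^ m) x = 0"
proof -
  define n where "n = degree (\<Lambda> x)"
  have "\<exists>m. (Dtop ^^ m) (pr (int i) x) = 0" for i
  proof -
    obtain m where "(D ^^ m) (pr (int i) x) = 0" using D_nilp pr_B assms by blast
    then show ?thesis
      using Dtop_power_homogeneous[OF pr_G[OF assms], of m "int i"] by auto
  qed
  then obtain m where m: "\<And>i. (Dtop ^^ m i) (pr (int i) x) = 0" by metis
  \<comment> \<open>A common exponent for all components: the sum bounds each of the finitely many
    \<open>m i\<close>.\<close>
  define M where "M = (\<Sum>i\<le>n. m i)"
  have "(Dtop ^^ M) (pr (int i) x) = 0" if "i \<le> n" for i
  proof -
    have "m i \<le> M" unfolding M_def by (rule member_le_sum) (use that in auto)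
    then have "M = (M - m i) + m i" by simp
    then have "(Dtop ^^ M) (pr (int i) x) = (Dtop ^^ (M - m i)) ((Dtop ^^ m i) (pr (int i) x))"
      by (metis funpow_add o_apply)
    then show ?thesis by (simp add: m)
  qed
  moreover have "x = (\<Sum>i\<le>n. pr (int i) x)" using sum_pr assms by (simp add: n_def)
  ultimately have "(Dtop ^^ M) x = 0"
    using Dtop_power_sum[of "{..n}" "\<lambda>i. pr (int i) x" M] pr_B assms by simp
  then show ?thesis by blast
qed

lemma lnd_Dtop: "lnd B G Dtop"
  by unfold_locales (use Dtop_B Dtop_add Dtop_mult Dtop_nilp in auto)

end

section \<open>Ruled extensions\<close>

text \<open>The field axioms for \<open>L\<close> are pulled back along \<open>\<Phi>\<close>.
  Negatives and inverses are required as members of the image, because in \<open>L\<close> they have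
  no meaning before it is known to be a field.\<close>

locale field_embedding =
  fixes L (structure) and \<Phi> :: "_ \<Rightarrow> 'f::field"
  assumes inj: "inj_on \<Phi> (carrier L)"
    and mult_closed: "x \<in> carrier L \<Longrightarrow> y \<in> carrier L \<Longrightarrow> x \<otimes> y \<in> carrier L"
    and add_closed: "x \<in> carrier L \<Longrightarrow> y \<in> carrier L \<Longrightarrow> x \<oplus> y \<in> carrier L"
    and one_in: "\<one> \<in> carrier L"
    and zero_in: "\<zero> \<in> carrier L"
    and \<Phi>_mult: "x \<in> carrier L \<Longrightarrow> y \<in> carrier L \<Longrightarrow> \<Phi> (x \<otimes> y) = \<Phi> x * \<Phi> y"
    and \<Phi>_add: "x \<in> carrier L \<Longrightarrow> y \<in> carrier L \<Longrightarrow> \<Phi> (x \<oplus> y) = \<Phi> x + \<Phi> y"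
    and \<Phi>_one: "\<Phi> \<one> = 1"
    and \<Phi>_zero: "\<Phi> \<zero> = 0"
    and img_uminus: "x \<in> carrier L \<Longrightarrow> - \<Phi> x \<in> \<Phi> ` carrier L"
    and img_inverse: "x \<in> carrier L \<Longrightarrow> \<Phi> x \<noteq> 0 \<Longrightarrow> inverse (\<Phi> x) \<in> \<Phi> ` carrier L"
begin

lemmas rules = mult_closed add_closed one_in zero_in \<Phi>_mult \<Phi>_add \<Phi>_one \<Phi>_zero

lemma eqI: "x \<in> carrier L \<Longrightarrow> y \<in> carrier L \<Longrightarrow> \<Phi> x = \<Phi> y \<Longrightarrow> x = y"
  using inj by (rule inj_onD)

lemma field_L: "field L"
proof -
  have "abelian_group L"
  proof (rule abelian_groupI)
    fix x assume x: "x \<in> carrier L"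
    then obtain y where y: "y \<in> carrier L" "\<Phi> y = - \<Phi> x" using img_uminus by (metis imageE)
    then have "y \<oplus> x = \<zero>" using x by (intro eqI) (auto simp: rules)
    then show "\<exists>y\<in>carrier L. y \<oplus> x = \<zero>" using y by blast
  qed (auto intro!: eqI simp: rules algebra_simps)
  moreover have "comm_monoid L"
    by (rule comm_monoidI) (auto intro!: eqI simp: rules algebra_simps)
  ultimately have "cring L"
    by (rule cringI) (auto intro!: eqI simp: rules algebra_simps)
  moreover have "Units L = carrier L - {\<zero>}"
  proof (intro equalityI subsetI)
    fix x assume "x \<in> Units L"
    then obtain y where y: "x \<in> carrier L" "y \<in> carrier L" "y \<otimes> x = \<one>"
      unfolding Units_def by blast
    then have "\<Phi> y * \<Phi> x = 1" by (metis \<Phi>_mult \<Phi>_one)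
    then show "x \<in> carrier L - {\<zero>}" using y \<Phi>_zero by auto
  next
    fix x assume "x \<in> carrier L - {\<zero>}"
    then have x: "x \<in> carrier L" "\<Phi> x \<noteq> 0" using eqI[of x \<zero>] zero_in \<Phi>_zero by auto
    then obtain y where y: "y \<in> carrier L" "\<Phi> y = inverse (\<Phi> x)" using img_inverse by (metis imageE)
    then have "y \<otimes> x = \<one>" "x \<otimes> y = \<one>" using x by (auto intro!: eqI simp: rules)
    then show "x \<in> Units L" using x y unfolding Units_def by blast
  qed
  ultimately show ?thesis by (rule cring.cring_fieldI)
qed

sublocale field L by (rule field_L)

lemma \<Phi>_uminus: "x \<in> carrier L \<Longrightarrow> \<Phi> (\<ominus> x) = - \<Phi> x"
  using \<Phi>_add[of x "\<ominus> x"] by (simp add: r_neg \<Phi>_zero eq_neg_iff_add_eq_0 add.commute)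

lemma \<Phi>_eq_0: "x \<in> carrier L \<Longrightarrow> \<Phi> x = 0 \<longleftrightarrow> x = \<zero>"
  using eqI[of x \<zero>] \<Phi>_zero by auto

lemma \<Phi>_inv: "x \<in> carrier L - {\<zero>} \<Longrightarrow> \<Phi> (inv x) = inverse (\<Phi> x)"
proof -
  assume x: "x \<in> carrier L - {\<zero>}"
  then have u: "x \<in> Units L" using field_Units by simp
  have "\<Phi> (x \<otimes> inv x) = \<Phi> x * \<Phi> (inv x)" using u by (intro \<Phi>_mult) auto
  then show ?thesis using u by (simp add: \<Phi>_one inverse_unique)
qed

lemma \<Phi>_pow: "x \<in> carrier L \<Longrightarrow> \<Phi> (x [^] (n::nat)) = \<Phi> x ^ n"
  by (induction n) (auto simp: \<Phi>_one \<Phi>_mult)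

text \<open>Polynomials over \<open>L\<close> are coefficient lists with the leading coefficient
  first, hence the exponent \<open>length l\<close> for the head.\<close>

primrec list_poly :: "_ list \<Rightarrow> 'f poly" where
  "list_poly [] = 0"
| "list_poly (y # l) = Polynomial.monom (\<Phi> y) (length l) + list_poly l"

lemma poly_list_poly:
  "set l \<subseteq> carrier L \<Longrightarrow> t \<in> carrier L \<Longrightarrow> poly (list_poly l) (\<Phi> t) = \<Phi> (eval l t)"
  by (induction l) (auto simp: \<Phi>_zero \<Phi>_add \<Phi>_mult \<Phi>_pow poly_monom eval_in_carrier)

lemma coeff_list_poly_ge: "length l \<le> n \<Longrightarrow> Polynomial.coeff (list_poly l) n = 0"
  by (induction l) auto

lemma coeff_list_poly:
  assumes "\<Phi> ` set l \<subseteq> K" "0 \<in> K" "\<And>x y. x \<in> K \<Longrightarrow> y \<in> K \<Longrightarrow> x + y \<in> K"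
  shows "Polynomial.coeff (list_poly l) n \<in> K"
  using assms(1) by (induction l) (auto simp: assms(2,3))

text \<open>Moves the conditions for a ruled extension into the ambient field. Generation is
  expressed by all sets \<open>R\<close> closed under the field operations; the proof takes for
  \<open>R\<close> the image of the generated subfield.\<close>

lemma ruled_extI:
  assumes K: "K \<subseteq> \<Phi> ` carrier L" "0 \<in> K" "1 \<in> K"
      "\<And>x y. x \<in> K \<Longrightarrow> y \<in> K \<Longrightarrow> x + y \<in> K" "\<And>x y. x \<in> K \<Longrightarrow> y \<in> K \<Longrightarrow> x * y \<in> K"
      "\<And>x. x \<in> K \<Longrightarrow> - x \<in> K" "\<And>x. x \<in> K \<Longrightarrow> inverse x \<in> K"
    and k0: "k0 \<subseteq> carrier L" "\<Phi> ` k0 \<subseteq> K"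
    and t: "t \<in> \<Phi> ` carrier L"
    and transc: "\<And>P. (\<And>j. Polynomial.coeff P j \<in> K) \<Longrightarrow> poly P t = 0 \<Longrightarrow> P = 0"
    and gen: "\<And>R. K \<subseteq> R \<Longrightarrow> t \<in> R \<Longrightarrow> (\<And>x y. x \<in> R \<Longrightarrow> y \<in> R \<Longrightarrow> x + y \<in> R) \<Longrightarrow>
      (\<And>x y. x \<in> R \<Longrightarrow> y \<in> R \<Longrightarrow> x * y \<in> R) \<Longrightarrow>
      (\<And>x. x \<in> R \<Longrightarrow> x \<noteq> 0 \<Longrightarrow> inverse x \<in> R) \<Longrightarrow> \<Phi> ` carrier L \<subseteq> R"
  shows "ruled_ext L k0"
proof -
  define K' where "K' = {x \<in> carrier L. \<Phi> x \<in> K}"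
  obtain t' where t': "t' \<in> carrier L" "\<Phi> t' = t" using t by auto
  have sub: "subfield K' L"
  proof (rule subfieldI')
    show "subring K' L"
      by (rule subringI) (auto simp: K'_def rules K \<Phi>_uminus)
    show "inv k \<in> K'" if "k \<in> K' - {\<zero>}" for k
    proof -
      have k: "k \<in> carrier L - {\<zero>}" "\<Phi> k \<in> K" using that by (auto simp: K'_def)
      then have "k \<in> Units L" using field_Units by simp
      then show ?thesis using \<Phi>_inv[OF k(1)] K(7)[OF k(2)] by (simp add: K'_def)
    qed
  qed
  have "transcendental K' t'"
  proof (rule ccontr)
    assume "algebraic K' t'"
    then have "(algebraic over K') t'" by (simp add: over_def)
    then obtain p where p: "p \<in> carrier (K' [X]\<^bsub>L\<^esub>)" "p \<noteq> []" "eval p t' = \<zero>"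
      using algebraicE[OF subfieldE(1)[OF sub] t'(1)] by blast
    have pol: "polynomial\<^bsub>L\<^esub> K' p" using p(1) by (simp add: univ_poly_carrier)
    obtain y l where l: "p = y # l" using p(2) by (cases p) auto
    have y: "y \<noteq> \<zero>" and s: "set p \<subseteq> K'" using pol l by (auto simp: polynomial_def)
    have sL: "set p \<subseteq> carrier L" using s by (auto simp: K'_def)
    have "poly (list_poly p) t = 0"
      using poly_list_poly[OF sL t'(1)] p(3) t'(2) by (simp add: \<Phi>_zero)
    moreover have "Polynomial.coeff (list_poly p) j \<in> K" for j
      by (rule coeff_list_poly) (use s K in \<open>auto simp: K'_def\<close>)
    ultimately have "list_poly p = 0" by (intro transc)
    \<comment> \<open>Only the leading coefficient \<open>y\<close> contributes to the exponent
      \<open>length l\<close>, and it is nonzero.\<close>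
    then have "Polynomial.coeff (list_poly p) (length l) = 0" by simp
    then show False using y sL by (simp add: l coeff_list_poly_ge \<Phi>_eq_0)
  qed
  moreover have "carrier L = generate_field L (insert t' K')"
  proof
    have inc: "insert t' K' \<subseteq> carrier L" using t' by (auto simp: K'_def)
    let ?g = "generate_field L (insert t' K')"
    show "?g \<subseteq> carrier L" by (rule generate_field_incl[OF inc])
    have gc: "x \<in> carrier L" if "x \<in> ?g" for x using generate_field_in_carrier[OF inc that] .
    have "\<Phi> ` carrier L \<subseteq> \<Phi> ` ?g"
    proof (rule gen)
      show "K \<subseteq> \<Phi> ` ?g"
      proof
        fix z assume z: "z \<in> K"
        then obtain z' where "z' \<in> carrier L" "z = \<Phi> z'" using K(1) by blast
        with z show "z \<in> \<Phi> ` ?g" by (auto simp: K'_def intro!: generate_field.incl)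
      qed
      show "t \<in> \<Phi> ` ?g" using t'(2) by (auto intro!: generate_field.incl)
      fix u v assume "u \<in> \<Phi> ` ?g" "v \<in> \<Phi> ` ?g"
      then obtain u' v' where u: "u' \<in> ?g" "u = \<Phi> u'" and v: "v' \<in> ?g" "v = \<Phi> v'" by blast
      show "u + v \<in> \<Phi> ` ?g"
        using \<Phi>_add[OF gc[OF u(1)] gc[OF v(1)]] generate_field.eng_add[OF u(1) v(1)] u v by (metis imageI)
      show "u * v \<in> \<Phi> ` ?g"
        using \<Phi>_mult[OF gc[OF u(1)] gc[OF v(1)]] generate_field.eng_mult[OF u(1) v(1)] u v by (metis imageI)
    next
      fix u assume "u \<in> \<Phi> ` ?g" "u \<noteq> 0"
      then obtain u' where u: "u' \<in> ?g" "u = \<Phi> u'" "u' \<noteq> \<zero>" using \<Phi>_zero by auto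
      show "inverse u \<in> \<Phi> ` ?g"
        using \<Phi>_inv[of u'] gc[OF u(1)] u generate_field.m_inv[OF u(1,3)]
        by (metis DiffI empty_iff imageI insert_iff)
    qed
    then show "carrier L \<subseteq> ?g"
      using inj inj_on_image_mem_iff[OF inj, of _ ?g] gc by blast
  qed
  moreover have "k0 \<subseteq> K'" using k0 by (auto simp: K'_def)
  ultimately show ?thesis unfolding ruled_ext_def using sub t'(1) by blast
qed

end

section \<open>The Pham-Brieskorn ring\<close>

text \<open>Bezout's identity, once for each element of \<open>I\<close>.\<close>

lemma Gcd_in_zspan:
  fixes f :: "'i \<Rightarrow> nat"
  assumes "finite I" "\<And>i. i \<in> I \<Longrightarrow> int (f i) \<in> zspan S"
  shows "int (Gcd (f ` I)) \<in> zspan S"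
  using assms
proof (induction I rule: finite_induct)
  case (insert i I)
  let ?g = "Gcd (f ` I)"
  obtain u v where "u * int (f i) + v * int ?g = gcd (int (f i)) (int ?g)"
    using bezout_int by blast
  moreover have "u * int (f i) + v * int ?g \<in> zspan S"
    using insert by (intro zspan_sum zspan_mult) auto
  ultimately have "int (gcd (f i) ?g) \<in> zspan S" by (simp add: gcd_int_int_eq)
  then show ?case by simp
qed (simp add: zspan.zero)

lemma lcmS_pos:
  fixes a :: "'v::finite \<Rightarrow> nat"
  assumes "\<And>i. a i > 0"
  shows "lcmS a > 0"
proof -
  have "0 \<notin> range a" using assms by (metis imageE less_irrefl)
  then have "Lcm (range a) \<noteq> 0" by (subst Lcm_0_iff) auto
  then show ?thesis unfolding lcmS_def by (rule gr0I[OF notE])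
qed

lemma mult_lcmS_div: "lcmS a div a i * a i = lcmS a"
  for a :: "'v::finite \<Rightarrow> nat"
  by (simp add: lcmS_def dvd_Lcm)

text \<open>By cotype 0, \<open>lcmS a\<close> is also the least common multiple of the entries
  other than \<open>a i\<close>. If \<open>g\<close> divides \<open>lcmS a div a j\<close> for all
  other \<open>j\<close>, then each such \<open>a j\<close> divides \<open>lcmS a div g\<close>;
  hence so does \<open>lcmS a\<close>, and \<open>g\<close> is 1.\<close>

lemma cotype_0_Gcd:
  fixes a :: "'v::finite \<Rightarrow> nat"
  assumes a: "\<And>i. a i > 0" and "cotype a = 0" "j0 \<noteq> i"
  shows "Gcd ((\<lambda>j. lcmS a div a j) ` (UNIV - {i})) = 1"
proof -
  define g where "g = Gcd ((\<lambda>j. lcmS a div a j) ` (UNIV - {i}))"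
  have L: "lcmS a > 0" by (rule lcmS_pos[OF a])
  have "a i dvd Lcm (a ` (UNIV - {i}))" using assms(2) by (simp add: cotype_def)
  moreover have "range a = insert (a i) (a ` (UNIV - {i}))" by auto
  ultimately have LL: "lcmS a = Lcm (a ` (UNIV - {i}))"
    unfolding lcmS_def by (metis Lcm_insert lcm_proj2_if_dvd_nat)
  have "g dvd lcmS a div a j0" unfolding g_def using \<open>j0 \<noteq> i\<close> by (auto intro!: Gcd_dvd)
  then have gL: "g dvd lcmS a" using mult_lcmS_div[of a j0] by (metis dvd_mult2)
  have "a j dvd lcmS a div g" if "j \<noteq> i" for j
  proof -
    have "g dvd lcmS a div a j" unfolding g_def using that by (auto intro!: Gcd_dvd)
    then have "g * a j dvd lcmS a" using mult_lcmS_div[of a j] by (metis mult_dvd_mono dvd_refl)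
    then show ?thesis using gL L by (metis dvd_div_iff_mult mult.commute dvd_0_left_iff less_numeral_extra(3))
  qed
  then have "lcmS a dvd lcmS a div g" unfolding LL by (auto intro!: Lcm_least)
  then have "lcmS a \<le> lcmS a div g" using L gL by (intro dvd_imp_le) (auto simp: dvd_div_eq_0_iff)
  then have "g \<le> 1" using L by (metis div_less_dividend linorder_not_less)
  moreover have "g \<noteq> 0" using gL L by auto
  ultimately show ?thesis unfolding g_def by linarith
qed

lemma homog_mult: "homog a d p \<Longrightarrow> homog a d' q \<Longrightarrow> homog a (d + d') (p * q :: ('v::finite, 'k::comm_ring_1) mpoly)"
proof -
  assume p: "homog a d p" and q: "homog a d' q"
  have "monodeg a (m + n) = monodeg a m + monodeg a n" for m n
    by (simp add: monodeg_def lookup_add distrib_right sum.distrib)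
  then show ?thesis using p q keys_mult[of p q] unfolding homog_def by fastforce
qed

lemma homog_add: "homog a d p \<Longrightarrow> homog a d q \<Longrightarrow> homog a d (p + q)"
  using Poly_Mapping.keys_add[of p q] unfolding homog_def by blast

lemma homog_uminus: "homog a d p \<Longrightarrow> homog a d (- p :: ('v::finite, 'k::comm_ring_1) mpoly)"
  unfolding homog_def by (simp add: in_keys_iff)

lemma monodeg_0 [simp]: "monodeg a 0 = 0"
  by (simp add: monodeg_def)

lemma monodeg_single [simp]: "monodeg a (Poly_Mapping.single i n) = n * (lcmS a div a i)"
proof -
  have "monodeg a (Poly_Mapping.single i n) = (\<Sum>j\<in>UNIV. if j = i then n * (lcmS a div a i) else 0)"
    unfolding monodeg_def by (rule sum.cong) (auto simp: lookup_single when_def)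
  then show ?thesis by simp
qed

section \<open>The ring and its grading embedded in a field\<close>

locale fermat_point = coeff_hom c
  for c :: "'k::field_char_0 \<Rightarrow> 'f::field_char_0" +
  fixes a :: "'v::finite \<Rightarrow> nat" and x :: "'v \<Rightarrow> 'f"
  assumes ker: "mev c x p = 0 \<longleftrightarrow> fermat a dvd p"
    and a_pos: "\<And>i. a i > 0"
    and card3: "card (UNIV :: 'v set) \<ge> 3"
begin

abbreviation \<psi> :: "('v, 'k) mpoly \<Rightarrow> 'f" where "\<psi> \<equiv> mev c x"

abbreviation wt :: "'v \<Rightarrow> nat" where "wt i \<equiv> lcmS a div a i"

lemma bcls_eq_iff: "bcls a p = bcls a q \<longleftrightarrow> \<psi> p = \<psi> q"
proof
  assume "bcls a p = bcls a q"
  moreover have "p \<in> bcls a p" unfolding bcls_def by (auto intro: exI[of _ 0])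
  ultimately obtain g where "p = q + fermat a * g" unfolding bcls_def by auto
  then show "\<psi> p = \<psi> q" using ker[of "fermat a * g"] by (simp add: mev_add)
next
  assume "\<psi> p = \<psi> q"
  then have "\<psi> (p - q) = 0" by (simp add: mev_diff)
  then obtain g where "p - q = fermat a * g" using ker by blast
  then have p: "p = q + fermat a * g" by (simp add: algebra_simps)
  have "p + fermat a * h = q + fermat a * (g + h)" "q + fermat a * h = p + fermat a * (h - g)" for h
    by (simp_all add: p algebra_simps)
  then show "bcls a p = bcls a q" unfolding bcls_def by blast
qed

text \<open>By \<open>ker\<close> the value neither depends on the representative nor agrees for two
  classes, so this embeds \<open>BS a\<close> in the field.\<close>

definition \<Psi> :: "('v, 'k) mpoly set \<Rightarrow> 'f" where "\<Psi> Z = \<psi> (brep Z)"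

lemma \<Psi>_bcls [simp]: "\<Psi> (bcls a p) = \<psi> p"
proof -
  have "p \<in> bcls a p" unfolding bcls_def by (auto intro: exI[of _ 0])
  then have "brep (bcls a p) \<in> bcls a p" unfolding brep_def by (rule someI)
  then obtain g where "brep (bcls a p) = p + fermat a * g" unfolding bcls_def by blast
  then show ?thesis using ker[of "fermat a * g"] by (simp add: \<Psi>_def mev_add)
qed

abbreviation BR where "BR \<equiv> (BS a :: ('v, 'k) mpoly set ring)"

lemma carrier_BS: "carrier BR = range (bcls a)"
  by (simp add: BS_def)

lemma BS_E: "Z \<in> carrier BR \<Longrightarrow> \<exists>p. Z = bcls a p"
  by (auto simp: carrier_BS)

lemma \<Psi>_eq_iff: "Z \<in> carrier BR \<Longrightarrow> Y \<in> carrier BR \<Longrightarrow> \<Psi> Z = \<Psi> Y \<longleftrightarrow> Z = Y"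
  unfolding carrier_BS by (elim imageE, hypsubst) (simp only: \<Psi>_bcls bcls_eq_iff)

lemma BS_closed:
  "Z \<otimes>\<^bsub>BR\<^esub> Y \<in> carrier BR" "Z \<oplus>\<^bsub>BR\<^esub> Y \<in> carrier BR" "\<one>\<^bsub>BR\<^esub> \<in> carrier BR" "\<zero>\<^bsub>BR\<^esub> \<in> carrier BR" "bscal a u \<in> carrier BR"
  by (auto simp: BS_def bscal_def)

lemma \<Psi>_hom:
  "\<Psi> (Z \<otimes>\<^bsub>BR\<^esub> Y) = \<Psi> Z * \<Psi> Y" "\<Psi> (Z \<oplus>\<^bsub>BR\<^esub> Y) = \<Psi> Z + \<Psi> Y"
  "\<Psi> \<one>\<^bsub>BR\<^esub> = 1" "\<Psi> \<zero>\<^bsub>BR\<^esub> = 0" "\<Psi> (bscal a u) = c u"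
  by (simp_all add: BS_def bscal_def mev_mult mev_add) (simp_all add: \<Psi>_def)

lemma \<Psi>_eq_0_iff: "Z \<in> carrier BR \<Longrightarrow> \<Psi> Z = 0 \<longleftrightarrow> Z = \<zero>\<^bsub>BR\<^esub>"
  using \<Psi>_eq_iff[of Z "\<zero>\<^bsub>BR\<^esub>"] BS_closed(4) \<Psi>_hom(4) by simp

definition FB :: "'f set" where "FB = range \<psi>"

definition FG :: "int \<Rightarrow> 'f set" where
  "FG d = {\<psi> p | p. p = 0 \<or> (d \<ge> 0 \<and> homog a (nat d) p)}"

lemma FG_I: "homog a d p \<Longrightarrow> \<psi> p \<in> FG (int d)"
  unfolding FG_def by auto

lemma FG_eq: "FG d = (if d < 0 then {0} else \<psi> ` {p. homog a (nat d) p})"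
proof -
  have "homog a n (0 :: ('v, 'k) mpoly)" for n by (simp add: homog_def)
  then show ?thesis unfolding FG_def by (auto simp: image_iff)
qed

lemma Bdeg_iff: "Z \<in> Bdeg a d \<longleftrightarrow> Z \<in> carrier BR \<and> \<Psi> Z \<in> FG d"
proof
  assume Z: "Z \<in> carrier BR \<and> \<Psi> Z \<in> FG d"
  then obtain p where p: "\<Psi> Z = \<psi> p" "p = 0 \<or> (d \<ge> 0 \<and> homog a (nat d) p)"
    unfolding FG_def by blast
  have "Z = bcls a p" using Z p(1) \<Psi>_eq_iff[of Z "bcls a p"] by (simp add: carrier_BS)
  then show "Z \<in> Bdeg a d" unfolding Bdeg_def using p(2) by blast
next
  assume "Z \<in> Bdeg a d"
  then obtain p where p: "Z = bcls a p" "p = 0 \<or> (d \<ge> 0 \<and> homog a (nat d) p)"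
    unfolding Bdeg_def by blast
  then show "Z \<in> carrier BR \<and> \<Psi> Z \<in> FG d"
    unfolding FG_def carrier_BS p(1) \<Psi>_bcls by blast
qed

lemma \<Psi>_FB: "Z \<in> carrier BR \<Longrightarrow> \<Psi> Z \<in> FB"
  by (auto simp: FB_def carrier_BS)

sublocale graded_domain FB FG
proof
  fix y z and d d' :: int
  show "y \<in> FB \<Longrightarrow> z \<in> FB \<Longrightarrow> y + z \<in> FB" unfolding FB_def by (auto simp flip: mev_add)
  show "y \<in> FB \<Longrightarrow> z \<in> FB \<Longrightarrow> y * z \<in> FB" unfolding FB_def by (auto simp flip: mev_mult)
  show "y \<in> FG d \<Longrightarrow> y \<in> FB" unfolding FB_def FG_def by auto
  show "0 \<in> FG d" unfolding FG_def by (auto intro!: exI[of _ 0])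
  have "homog a 0 (1 :: ('v, 'k) mpoly)" by (simp add: homog_def)
  then show "1 \<in> FG 0" using FG_I[of 0 1] by simp
  show "y \<in> FG d \<Longrightarrow> z \<in> FG d \<Longrightarrow> y + z \<in> FG d"
    unfolding FG_eq by (auto simp flip: mev_add intro!: homog_add imageI split: if_splits)
  show "y \<in> FG d \<Longrightarrow> - y \<in> FG d"
    unfolding FG_eq by (auto simp flip: mev_uminus intro!: homog_uminus imageI split: if_splits)
  show "y * z \<in> FG (d + d')" if "y \<in> FG d" "z \<in> FG d'"
  proof -
    from that obtain p q where p: "y = \<psi> p" "p = 0 \<or> (d \<ge> 0 \<and> homog a (nat d) p)"
      and q: "z = \<psi> q" "q = 0 \<or> (d' \<ge> 0 \<and> homog a (nat d') q)"
      unfolding FG_def by blast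
    then have "p * q = 0 \<or> (d + d' \<ge> 0 \<and> homog a (nat (d + d')) (p * q))"
      using homog_mult[of a "nat d" p "nat d'" q] by (auto simp: nat_add_distrib)
    then show ?thesis unfolding FG_def p(1) q(1) mev_mult[symmetric] by blast
  qed
qed

lemma x_FG: "x i \<in> FG (int (wt i))"
proof -
  have "homog a (wt i) (Xvar i :: ('v, 'k) mpoly)" by (simp add: homog_def Xvar_def)
  then have "\<psi> (Xvar i) \<in> FG (int (wt i))" by (rule FG_I)
  then show ?thesis by simp
qed

lemma c_FG: "c u \<in> FG 0"
proof -
  have "homog a 0 (Cst u :: ('v, 'k) mpoly)" by (simp add: homog_def Cst_def)
  then have "\<psi> (Cst u) \<in> FG (int 0)" by (rule FG_I)
  then show ?thesis by simp
qed

text \<open>The exponent of the new variable records the weighted degree; the map will descend to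
  \<open>\<Lambda>\<close>.\<close>

definition \<chi> :: "('v, 'k) mpoly \<Rightarrow> 'f poly" where
  "\<chi> = mev (\<lambda>u. [:c u:]) (\<lambda>i. Polynomial.monom (x i) (wt i))"

lemma coeff_hom_const: "coeff_hom (\<lambda>u. [:c u:])"
  by (rule coeff_hom_comp) (auto simp: one_pCons)

interpretation const: coeff_hom "\<lambda>u. [:c u:]" by (rule coeff_hom_const)

lemma monom_power: "Polynomial.monom (u::'f) k ^ n = Polynomial.monom (u ^ n) (n * k)"
  by (induction n) (auto simp: mult_monom one_pCons monom_0)

lemma prod_monom: "(\<Prod>i\<in>I. Polynomial.monom (f i :: 'f) (k i)) = Polynomial.monom (\<Prod>i\<in>I. f i) (\<Sum>i\<in>I. k i)"
  by (induction I rule: infinite_finite_induct) (auto simp: mult_monom one_pCons monom_0)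

lemma \<chi>_single: "\<chi> (Poly_Mapping.single m u) = Polynomial.monom (\<psi> (Poly_Mapping.single m u)) (monodeg a m)"
  unfolding \<chi>_def const.mev_single mev_single monom_power prod_monom
  by (simp add: smult_monom monodeg_def)

lemma \<chi>_expand: "\<chi> p = (\<Sum>m\<in>Poly_Mapping.keys p. Polynomial.monom (\<psi> (Poly_Mapping.single m (Poly_Mapping.lookup p m))) (monodeg a m))"
proof -
  have "\<chi> p = \<chi> (\<Sum>m\<in>Poly_Mapping.keys p. Poly_Mapping.single m (Poly_Mapping.lookup p m))"
    using poly_mapping_sum_single[of p] by simp
  then show ?thesis by (simp add: \<chi>_def const.mev_sum) (simp add: \<chi>_single[unfolded \<chi>_def])
qed

lemma \<psi>_expand: "\<psi> p = (\<Sum>m\<in>Poly_Mapping.keys p. \<psi> (Poly_Mapping.single m (Poly_Mapping.lookup p m)))"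
  by (subst poly_mapping_sum_single) (rule mev_sum)

lemma \<chi>_homog: "homog a d p \<Longrightarrow> \<chi> p = Polynomial.monom (\<psi> p) d"
  unfolding \<chi>_expand homog_def
  by (subst \<psi>_expand) (simp add: monom_sum)

lemma poly_\<chi>: "poly (\<chi> p) 1 = \<psi> p"
  by (simp add: \<chi>_expand poly_sum poly_monom) (rule \<psi>_expand[symmetric])

text \<open>The Fermat polynomial is homogeneous of degree \<open>lcmS a\<close> and vanishes at
  \<open>x\<close>, so \<open>\<chi>\<close> sends it to zero and factors through the ring.\<close>

lemma \<chi>_cong:
  assumes "\<psi> p = \<psi> q"
  shows "\<chi> p = \<chi> q"
proof -
  have "homog a (lcmS a) (fermat a :: ('v, 'k) mpoly)"
  proof -
    have "homog a (lcmS a) (Xvar i ^ a i :: ('v, 'k) mpoly)" for i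
      using mult_lcmS_div[of a i] by (simp add: Xvar_power homog_def mult.commute)
    moreover have "homog a d (\<Sum>i\<in>I. h i)" if "\<And>i. homog a d (h i)" for d and I :: "'v set" and h :: "'v \<Rightarrow> ('v, 'k) mpoly"
      by (induction I rule: infinite_finite_induct) (auto intro: homog_add that simp: homog_def[of _ _ 0])
    ultimately show ?thesis unfolding fermat_def by simp
  qed
  then have "\<chi> (fermat a) = 0" using \<chi>_homog ker[of "fermat a"] by simp
  moreover have "\<psi> (p - q) = 0" using assms by (simp add: mev_diff)
  then obtain g where "p - q = fermat a * g" using ker by blast
  then have "\<chi> (p - q) = \<chi> (fermat a * g)" by simp
  then have "\<chi> p - \<chi> q = \<chi> (fermat a) * \<chi> g"
    by (simp only: \<chi>_def const.mev_diff const.mev_mult)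
  ultimately show ?thesis by simp
qed

definition \<Lambda> :: "'f \<Rightarrow> 'f poly" where "\<Lambda> z = \<chi> (SOME p. \<psi> p = z)"

lemma \<Lambda>_\<psi> [simp]: "\<Lambda> (\<psi> p) = \<chi> p"
  unfolding \<Lambda>_def by (rule \<chi>_cong) (rule someI[of "\<lambda>q. \<psi> q = \<psi> p"], simp)

sublocale nat_graded_domain FB FG \<Lambda>
proof
  fix y z and d :: int and n
  show "y \<in> FB \<Longrightarrow> z \<in> FB \<Longrightarrow> \<Lambda> (y + z) = \<Lambda> y + \<Lambda> z"
    unfolding FB_def by (auto simp flip: mev_add) (simp add: \<chi>_def const.mev_add)
  show "y \<in> FB \<Longrightarrow> z \<in> FB \<Longrightarrow> \<Lambda> (y * z) = \<Lambda> y * \<Lambda> z"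
    unfolding FB_def by (auto simp flip: mev_mult) (simp add: \<chi>_def const.mev_mult)
  show "y \<in> FG d \<Longrightarrow> \<Lambda> y = Polynomial.monom y (nat d)"
    unfolding FG_def using \<chi>_homog \<Lambda>_\<psi>[of 0] by (auto simp: \<chi>_def simp del: \<Lambda>_\<psi>) (simp add: \<chi>_def[symmetric])
  show "y \<in> FB \<Longrightarrow> poly (\<Lambda> y) 1 = y"
    unfolding FB_def by (auto simp: poly_\<chi>)
  show "y \<in> FG d \<Longrightarrow> d < 0 \<Longrightarrow> y = 0"
    unfolding FG_def by auto
  show "Polynomial.coeff (\<Lambda> y) n \<in> FG (int n)" if "y \<in> FB"
  proof -
    from that obtain p where p: "y = \<psi> p" unfolding FB_def by blast
    have "\<psi> (Poly_Mapping.single m u) \<in> FG (int (monodeg a m))" for m u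
      by (rule FG_I) (simp add: homog_def)
    then show ?thesis
      unfolding p \<Lambda>_\<psi> \<chi>_expand coeff_sum by (intro G_sum) (auto simp: G_0)
  qed
qed

end

section \<open>Reduction modulo a variable\<close>

lemma single_eq_prod: "Poly_Mapping.single m u = Cst u * (\<Prod>i\<in>UNIV. Xvar i ^ Poly_Mapping.lookup m i)"
  for m :: "'v::finite \<Rightarrow>\<^sub>0 nat" and u :: "'k::comm_ring_1"
proof -
  have "(\<Sum>i\<in>UNIV. Poly_Mapping.single i (Poly_Mapping.lookup m i)) = m"
    by (rule poly_mapping_eqI) (simp add: lookup_sum lookup_single when_def)
  then show ?thesis by (simp add: prod_Xvar Cst_def mult_single)
qed

lemma mpoly_ring_induct [case_names Cst Xvar add mult]:
  fixes p :: "('v::finite, 'k::comm_ring_1) mpoly"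
  assumes Cst: "\<And>u. P (Cst u)" and Xvar: "\<And>i. P (Xvar i)"
    and add: "\<And>p q. P p \<Longrightarrow> P q \<Longrightarrow> P (p + q)" and mult: "\<And>p q. P p \<Longrightarrow> P q \<Longrightarrow> P (p * q)"
  shows "P p"
proof (induction p rule: mpoly_induct)
  case (single m u)
  have 1: "P 1" using Cst[of 1] by (simp add: Cst_def)
  have pow: "P (p ^ n)" if "P p" for p n
    by (induction n) (auto intro: 1 mult that)
  have "P (\<Prod>i\<in>I. Xvar i ^ Poly_Mapping.lookup m i)" for I
    by (induction I rule: infinite_finite_induct) (auto intro: 1 mult pow Xvar)
  then show ?case unfolding single_eq_prod by (intro mult Cst)
qed (rule add)

text \<open>Reduction modulo \<open>Xvar i\<close>, realised as a substitution within the same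
  ring.\<close>

definition drop_var :: "'v \<Rightarrow> ('v::finite, 'k::comm_ring_1) mpoly \<Rightarrow> ('v, 'k) mpoly" where
  "drop_var i = mev Cst (\<lambda>l. if l = i then 0 else Xvar l)"

interpretation Cst: coeff_hom "Cst :: 'k::comm_ring_1 \<Rightarrow> ('v::finite, 'k) mpoly"
  by (rule coeff_hom_Cst)

lemmas drop_var_simps = Cst.mev_add[where x = "\<lambda>l. if l = i then 0 else Xvar l" for i, folded drop_var_def]
  Cst.mev_diff[where x = "\<lambda>l. if l = i then 0 else Xvar l" for i, folded drop_var_def]
  Cst.mev_mult[where x = "\<lambda>l. if l = i then 0 else Xvar l" for i, folded drop_var_def]
  Cst.mev_Cst[where x = "\<lambda>l. if l = i then 0 else Xvar l" for i, folded drop_var_def]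
  Cst.mev_sum[where x = "\<lambda>l. if l = i then 0 else Xvar l" for i, folded drop_var_def]
  Cst.mev_power[where x = "\<lambda>l. if l = i then 0 else Xvar l" for i, folded drop_var_def]
  Cst.mev_Xvar[where x = "\<lambda>l. if l = i then 0 else Xvar l" for i, folded drop_var_def]

lemma drop_var_uminus: "drop_var i (- p) = - drop_var i p"
  unfolding drop_var_def by (rule Cst.mev_uminus)

lemma Xvar_dvd_diff_drop_var: "Xvar i dvd p - drop_var i p"
proof (induction p rule: mpoly_ring_induct)
  case (Xvar j)
  then show ?case by (simp add: drop_var_simps)
next
  case (add p q)
  have "p + q - drop_var i (p + q) = (p - drop_var i p) + (q - drop_var i q)"
    by (simp add: drop_var_simps)
  then show ?case using add by (metis dvd_add)
next
  case (mult p q)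
  have "p * q - drop_var i (p * q) = p * (q - drop_var i q) + drop_var i q * (p - drop_var i p)"
    by (simp add: drop_var_simps algebra_simps)
  then show ?case using mult by (metis dvd_add dvd_mult)
qed (simp add: drop_var_simps)

lemma drop_var_sum_powers:
  assumes "\<And>l. a l > 0"
  shows "drop_var i (\<Sum>l\<in>I. Xvar l ^ a l) = (\<Sum>l\<in>I - {i}. Xvar l ^ a l)"
proof -
  have "drop_var i (\<Sum>l\<in>I. Xvar l ^ a l) = (\<Sum>l\<in>I. if l = i then 0 else Xvar l ^ a l)"
    unfolding drop_var_simps using assms by (intro sum.cong) (auto simp: zero_power)
  also have "\<dots> = (\<Sum>l\<in>I - {i}. Xvar l ^ a l)"
    by (rule sum.mono_neutral_cong_right) auto
  finally show ?thesis .
qed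

lemma Xvar_neq_0: "(Xvar i :: ('v, 'k::comm_ring_1) mpoly) \<noteq> 0"
  unfolding Xvar_def by (metis lookup_single_eq lookup_zero zero_neq_one)

text \<open>Modulo \<open>Xvar i\<close> and \<open>Xvar j\<close> the Fermat polynomial stays
  nonzero because of its term at \<open>l\<close>. So modulo \<open>Xvar i\<close> the cofactor
  \<open>H\<close> is divisible by \<open>Xvar j\<close>; cancelling this factor makes
  \<open>U\<close> a multiple of the Fermat polynomial modulo \<open>Xvar i\<close>.\<close>

lemma Xvar_coprime_mod_fermat:
  fixes U V H :: "('v::finite, 'k::idom) mpoly"
  assumes a: "\<And>l. a l > 0" and "l \<noteq> i" "l \<noteq> j" and e: "Xvar i * V - Xvar j * U = fermat a * H" and "i \<noteq> j"
  shows "\<exists>W W'. U = Xvar i * W + fermat a * W'"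
proof -
  have "drop_var i (Xvar i * V - Xvar j * U) = drop_var i (fermat a * H)" using e by simp
  then have e1: "Xvar j * (- drop_var i U) = drop_var i (fermat a) * drop_var i H"
    using assms(5) by (simp add: drop_var_simps)
  then have "drop_var j (Xvar j * (- drop_var i U)) = drop_var j (drop_var i (fermat a) * drop_var i H)" by simp
  then have "drop_var j (drop_var i (fermat a)) * drop_var j (drop_var i H) = 0"
    by (simp add: drop_var_simps drop_var_uminus)
  moreover have "drop_var j (drop_var i (fermat a)) \<noteq> (0 :: ('v, 'k) mpoly)"
    unfolding fermat_def drop_var_sum_powers[OF a] using assms(2,3) by (intro sum_Xvar_powers_neq_0[of l] a) auto
  ultimately have "drop_var j (drop_var i H) = 0" by (simp add: mpoly_mult_eq_0_iff)
  then obtain W where W: "drop_var i H = Xvar j * W"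
    using Xvar_dvd_diff_drop_var[of j "drop_var i H"] by auto
  have "Xvar j * (- drop_var i U) = Xvar j * (drop_var i (fermat a) * W)"
    using e1 by (simp add: W mult_ac)
  then have U1: "- drop_var i U = drop_var i (fermat a) * W"
    by (rule mpoly_mult_left_cancel[OF Xvar_neq_0])
  obtain U' where U': "U - drop_var i U = Xvar i * U'" using Xvar_dvd_diff_drop_var by (metis dvdE)
  obtain F' where F': "fermat a - drop_var i (fermat a) = Xvar i * (F' :: ('v, 'k) mpoly)"
    using Xvar_dvd_diff_drop_var by (metis dvdE)
  have "U = Xvar i * U' + drop_var i U" using U' by (simp add: algebra_simps)
  moreover have "drop_var i U = - ((fermat a - Xvar i * F') * W)"
    using U1 by (simp add: F'[symmetric]) (metis minus_minus)
  ultimately have "U = Xvar i * (U' + F' * W) + fermat a * (- W)" by (simp add: algebra_simps)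
  then show ?thesis by blast
qed

text \<open>A cofactor would vanish modulo \<open>Xvar i\<close>; after cancelling
  \<open>Xvar i\<close> the Fermat polynomial would be a unit, yet it vanishes at the
  origin.\<close>

lemma fermat_not_dvd_Xvar:
  fixes i :: "'v::finite"
  assumes a: "\<And>l. a l > 0" and "l \<noteq> i"
  shows "\<not> fermat a dvd (Xvar i :: ('v, 'k::idom) mpoly)"
proof
  assume "fermat a dvd (Xvar i :: ('v, 'k) mpoly)"
  then obtain g where g: "(Xvar i :: ('v, 'k) mpoly) = fermat a * g" by blast
  then have "drop_var i (Xvar i :: ('v, 'k) mpoly) = drop_var i (fermat a * g)" by simp
  then have "drop_var i (fermat a) * drop_var i g = 0" by (simp add: drop_var_simps)
  moreover have "drop_var i (fermat a) \<noteq> (0 :: ('v, 'k) mpoly)"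
    unfolding fermat_def drop_var_sum_powers[OF a] using assms(2) by (intro sum_Xvar_powers_neq_0[of l] a) auto
  ultimately have "drop_var i g = 0" by (simp add: mpoly_mult_eq_0_iff)
  then obtain h where h: "g = Xvar i * h" using Xvar_dvd_diff_drop_var[of i g] by auto
  have "Xvar i * 1 = Xvar i * (fermat a * h)" using g by (simp add: h mult_ac)
  then have "1 = fermat a * h" by (rule mpoly_mult_left_cancel[OF Xvar_neq_0])
  then have "mev Cst (\<lambda>_. 0) (1 :: ('v, 'k) mpoly) = (mev Cst (\<lambda>_. 0) (fermat a * h) :: ('v, 'k) mpoly)" by simp
  then have "(1 :: ('v, 'k) mpoly) = 0"
    using a by (simp add: Cst.mev_mult Cst.mev_fermat zero_power)
  then show False by simp
qed

text \<open>The condition on pairs leaves at most one index whose weight is outside the group, and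
  by cotype 0 the other weights have greatest common divisor 1.\<close>

lemma zspan_eq_UNIV:
  fixes a :: "'v::finite \<Rightarrow> nat"
  assumes "\<And>i. a i > 0" "cotype a = 0" and "i0 \<noteq> (j0 :: 'v)"
    and S: "\<And>i j. i \<noteq> j \<Longrightarrow> int (lcmS a div a i) \<in> zspan S \<or> int (lcmS a div a j) \<in> zspan S"
  shows "zspan S = UNIV"
proof -
  have "\<exists>i. \<forall>j. j \<noteq> i \<longrightarrow> int (lcmS a div a j) \<in> zspan S" using S by blast
  then obtain i where i: "\<And>j. j \<in> UNIV - {i} \<Longrightarrow> int (lcmS a div a j) \<in> zspan S" by auto
  obtain j where "j \<noteq> i" using assms(3) by metis
  have "int (Gcd ((\<lambda>j. lcmS a div a j) ` (UNIV - {i}))) \<in> zspan S"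
    by (rule Gcd_in_zspan) (use i in auto)
  then have "1 \<in> zspan S"
    using cotype_0_Gcd[OF assms(1,2) \<open>j \<noteq> i\<close>] by simp
  then have "k * 1 \<in> zspan S" for k by (rule zspan_mult)
  then show ?thesis by auto
qed

section \<open>Derivations of the ring and the degrees of their kernels: part (a)\<close>

context fermat_point
begin

lemma other_index: obtains l where "l \<noteq> i" "l \<noteq> (j :: 'v)"
proof -
  have "\<not> UNIV \<subseteq> {i, j}"
    using card3 card_mono[of "{i, j}" UNIV] card_insert_le_m1[of 2 "{j}" i] by auto
  then show ?thesis using that by blast
qed

lemma x_neq_0: "x i \<noteq> 0"
proof -
  obtain l where "l \<noteq> i" using other_index by blast
  then show ?thesis using fermat_not_dvd_Xvar[of a l i] a_pos ker[of "Xvar i"] by simp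
qed

lemma x_coprime:
  assumes "i \<noteq> j" "u \<in> FB" "v \<in> FB" "x i * v = x j * u"
  shows "\<exists>w\<in>FB. u = x i * w"
proof -
  obtain U V where UV: "u = \<psi> U" "v = \<psi> V" using assms unfolding FB_def by blast
  then have "\<psi> (Xvar i * V - Xvar j * U) = 0" using assms(4) by (simp add: mev_diff mev_mult)
  then obtain H where H: "Xvar i * V - Xvar j * U = fermat a * H" using ker by blast
  obtain l where "l \<noteq> i" "l \<noteq> j" by (rule other_index)
  then obtain W W' where W: "U = Xvar i * W + fermat a * W'"
    using Xvar_coprime_mod_fermat[OF a_pos _ _ H assms(1)] by blast
  have "\<psi> (fermat a) = 0" using ker[of "fermat a"] by simp
  then have "u = x i * \<psi> W" by (simp add: UV W mev_add mev_mult)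
  then show ?thesis unfolding FB_def by blast
qed

text \<open>The kernel is a subring, and the constants and the variables generate the whole
  ring.\<close>

lemma lnd_eq_0:
  assumes "lnd FB FG D" "\<And>u. D (c u) = 0" "\<And>i. D (x i) = 0" "y \<in> FB"
  shows "D y = 0"
proof -
  interpret lnd FB FG D by fact
  obtain p where y: "y = \<psi> p" using assms(4) unfolding FB_def by blast
  have "\<psi> p \<in> A"
  proof (induction p rule: mpoly_ring_induct)
    case (Cst u)
    then show ?case using assms(2) G_B[OF c_FG] by (simp add: A_def)
  next
    case (Xvar i)
    then show ?case using assms(3) G_B[OF x_FG] by (simp add: A_def)
  qed (auto simp: mev_add mev_mult intro: A_add A_mult)
  then show ?thesis by (simp add: y A_def)
qed

text \<open>The slice is the last but one nonzero iterate of \<open>D\<close> on \<open>x i\<close>;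
  it is homogeneous because \<open>D\<close> is.\<close>

lemma slice_exists:
  assumes "lnd FB FG D" and G: "\<And>d y. y \<in> FG d \<Longrightarrow> D y \<in> FG (d + e)" and "D (x i) \<noteq> 0"
  shows "\<exists>s ds. homogeneous_slice FB FG D s e ds"
proof -
  interpret lnd FB FG D by fact
  have xB: "x i \<in> FB" by (rule G_B[OF x_FG])
  obtain r where r: "(D ^^ r) (D (x i)) \<noteq> 0" "(D ^^ Suc r) (D (x i)) = 0"
    using last_nonzero[OF D_B[OF xB] assms(3)] .
  define s where "s = (D ^^ r) (x i)"
  have Ds: "D s = (D ^^ r) (D (x i))" by (simp add: s_def funpow_swap1)
  have "(D ^^ n) (x i) \<in> FG (int (wt i) + int n * e)" for n
  proof (induction n)
    case (Suc n)
    then show ?case using G[of "(D ^^ n) (x i)" "int (wt i) + int n * e"] by (simp add: algebra_simps)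
  qed (simp add: x_FG)
  then have sG: "s \<in> FG (int (wt i) + int r * e)" by (simp add: s_def)
  have "homogeneous_slice FB FG D s e (int (wt i) + int r * e)"
  proof unfold_locales
    show "s \<in> FB" unfolding s_def by (rule Dn_B[OF xB])
    show "D s \<noteq> 0" "D (D s) = 0" using r by (simp_all add: Ds)
  qed (use sG G in auto)
  then show ?thesis by blast
qed

lemma zspan_kdegs:
  assumes "homogeneous_slice FB FG D s e ds" "cotype a = 0"
  shows "zspan (homogeneous_slice.kdegs FB FG D) = UNIV"
proof -
  interpret homogeneous_slice FB FG D s e ds by fact
  obtain i j :: 'v where "i \<noteq> j" using other_index by metis
  then show ?thesis
  proof (rule zspan_eq_UNIV[OF a_pos assms(2)])
    fix i j :: 'v assume "i \<noteq> j"
    then show "int (wt i) \<in> zspan kdegs \<or> int (wt j) \<in> zspan kdegs"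
      by (intro one_degree_in_kdegs[OF x_FG x_FG x_neq_0] x_coprime)
  qed
qed

text \<open>The derivation of residue classes, read on their values in the field. The choice of
  \<open>p\<close> is immaterial, as equal values mean equal classes.\<close>

definition transport where
  "transport D z = \<Psi> (D (bcls a (SOME p. \<psi> p = z)))"

lemma transport_\<Psi>:
  assumes "Z \<in> carrier BR"
  shows "transport D (\<Psi> Z) = \<Psi> (D Z)"
proof -
  obtain p where p: "Z = bcls a p" using BS_E assms by blast
  have "\<psi> (SOME q. \<psi> q = \<psi> p) = \<psi> p" by (rule someI[of "\<lambda>q. \<psi> q = \<psi> p"]) simp
  then have "bcls a (SOME q. \<psi> q = \<psi> p) = bcls a p" using bcls_eq_iff by blast
  then show ?thesis unfolding transport_def p \<Psi>_bcls by simp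
qed

lemma FB_E: "z \<in> FB \<Longrightarrow> (\<And>Z. Z \<in> carrier BR \<Longrightarrow> z = \<Psi> Z \<Longrightarrow> P) \<Longrightarrow> P"
  unfolding FB_def carrier_BS using \<Psi>_bcls by (metis rangeE rangeI)

lemma lnd_transport:
  assumes "is_LND a D"
  shows "lnd FB FG (transport D)"
proof -
  have D: "is_kder a D" using assms by (simp add: is_LND_def)
  have Dc: "D Z \<in> carrier BR" if "Z \<in> carrier BR" for Z using D that by (auto simp: is_kder_def)
  have tp: "((transport D) ^^ m) (\<Psi> Z) = \<Psi> ((D ^^ m) Z) \<and> (D ^^ m) Z \<in> carrier BR" if "Z \<in> carrier BR" for Z m
    by (induction m) (auto simp: that transport_\<Psi> Dc)
  show ?thesis
  proof unfold_locales
    fix y z assume "y \<in> FB" "z \<in> FB"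
    then obtain Y Z where Y: "Y \<in> carrier BR" "y = \<Psi> Y" and Z: "Z \<in> carrier BR" "z = \<Psi> Z" by (metis FB_E)
    show "transport D (y + z) = transport D y + transport D z"
      using D Y Z by (simp add: is_kder_def transport_\<Psi> BS_closed \<Psi>_hom flip: \<Psi>_hom(2))
    show "transport D (y * z) = y * transport D z + transport D y * z"
      using D Y Z by (simp add: is_kder_def transport_\<Psi> BS_closed \<Psi>_hom flip: \<Psi>_hom(1))
  next
    fix y assume "y \<in> FB"
    then obtain Y where Y: "Y \<in> carrier BR" "y = \<Psi> Y" by (rule FB_E)
    show "transport D y \<in> FB" using Y by (simp add: transport_\<Psi> \<Psi>_FB Dc)
    obtain m where "(D ^^ m) Y = \<zero>\<^bsub>BR\<^esub>" using assms Y unfolding is_LND_def by blast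
    then show "\<exists>m. ((transport D) ^^ m) y = 0" using tp[OF Y(1), of m] Y(2) \<Psi>_hom(4) by auto
  qed
qed

text \<open>Linearity over the constants moves \<open>c u\<close> out of the derivation, which kills
  1.\<close>

lemma transport_c:
  assumes "is_LND a D"
  shows "transport D (c u) = 0"
proof -
  interpret lnd FB FG "transport D" by (rule lnd_transport[OF assms])
  have "transport D 1 = 0" by (rule D_1)
  then have 1: "\<Psi> (D \<one>\<^bsub>BR\<^esub>) = 0" using transport_\<Psi>[OF BS_closed(3), of D] by (simp add: \<Psi>_hom)
  have "c u = \<Psi> (bscal a u \<otimes>\<^bsub>BR\<^esub> \<one>\<^bsub>BR\<^esub>)" by (simp add: \<Psi>_hom)
  then have "transport D (c u) = \<Psi> (D (bscal a u \<otimes>\<^bsub>BR\<^esub> \<one>\<^bsub>BR\<^esub>))"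
    by (simp add: transport_\<Psi> BS_closed)
  also have "D (bscal a u \<otimes>\<^bsub>BR\<^esub> \<one>\<^bsub>BR\<^esub>) = bscal a u \<otimes>\<^bsub>BR\<^esub> D \<one>\<^bsub>BR\<^esub>"
    using assms BS_closed(3) unfolding is_LND_def is_kder_def by blast
  finally show ?thesis using 1 by (simp add: \<Psi>_hom)
qed

lemma Zgrp_derker:
  fixes D :: "('v, 'k) mpoly set \<Rightarrow> ('v, 'k) mpoly set"
  assumes D: "D \<in> HLND a" and cot: "cotype a = 0"
  shows "Zgrp a (derker a D) = UNIV"
proof -
  have L: "is_LND a D" using D by (simp add: HLND_def)
  interpret lnd FB FG "transport D" by (rule lnd_transport[OF L])
  obtain e where e: "\<And>d Z. Z \<in> Bdeg a d \<Longrightarrow> D Z \<in> Bdeg a (d + e)"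
    using D unfolding HLND_def is_homog_der_def by blast
  define S where "S = {i. \<exists>Z\<in>derker a D \<inter> Bdeg a i. Z \<noteq> \<zero>\<^bsub>BR\<^esub>}"
  have S: "d \<in> S" if y: "y \<in> A" "y \<in> FG d" "y \<noteq> 0" for y d
  proof -
    obtain Z where Z: "Z \<in> carrier BR" "y = \<Psi> Z" using A_B[OF y(1)] by (rule FB_E)
    have DZ: "D Z \<in> carrier BR" using L Z(1) by (auto simp: is_LND_def is_kder_def)
    have "\<Psi> (D Z) = 0" using y(1) Z by (simp add: A_def transport_\<Psi>)
    then have "Z \<in> derker a D" using \<Psi>_eq_0_iff[OF DZ] Z(1) by (simp add: derker_def)
    moreover have "Z \<in> Bdeg a d" using Z y(2) Bdeg_iff by simp
    moreover have "Z \<noteq> \<zero>\<^bsub>BR\<^esub>" using y(3) Z \<Psi>_hom(4) by auto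
    ultimately show ?thesis unfolding S_def by blast
  qed
  have "zspan S = UNIV"
  proof (cases "\<forall>i. transport D (x i) = 0")
    \<comment> \<open>A derivation killing all variables has no local slice, but then the weights
      themselves are degrees of the kernel.\<close>
    case True
    obtain i j :: 'v where "i \<noteq> j" using other_index by metis
    then show ?thesis
    proof (rule zspan_eq_UNIV[OF a_pos cot])
      fix i j :: 'v
      have "x i \<in> A" using True G_B[OF x_FG] by (simp add: A_def)
      then have "int (wt i) \<in> S" by (rule S) (rule x_FG, rule x_neq_0)
      then show "int (wt i) \<in> zspan S \<or> int (wt j) \<in> zspan S" using zspan_base by blast
    qed
  next
    case False
    then obtain i where i: "transport D (x i) \<noteq> 0" by blast
    have tG: "transport D y \<in> FG (d + e)" if y: "y \<in> FG d" for y d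
    proof -
      obtain Z where Z: "Z \<in> carrier BR" "y = \<Psi> Z" using G_B[OF y] by (rule FB_E)
      then have "Z \<in> Bdeg a d" using y Bdeg_iff by simp
      then show ?thesis using e[of Z d] Bdeg_iff Z by (simp add: transport_\<Psi>)
    qed
    obtain s ds where h: "homogeneous_slice FB FG (transport D) s e ds"
      using slice_exists[OF lnd_axioms tG i] by blast
    interpret homogeneous_slice FB FG "transport D" s e ds by fact
    have "kdegs \<subseteq> S" unfolding kdegs_def using S by blast
    then have "zspan kdegs \<subseteq> zspan S"
    proof (intro subsetI)
      fix z assume k: "kdegs \<subseteq> S" and "z \<in> zspan kdegs"
      from this(2) show "z \<in> zspan S"
        by (induction z rule: zspan.induct) (use k in \<open>auto intro: zspan.intros\<close>)
    qed
    then show ?thesis using zspan_kdegs[OF h cot] by blast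
  qed
  then show ?thesis by (simp add: Zgrp_def S_def)
qed

end

section \<open>The function field and part (b)\<close>

context fermat_point
begin

abbreviation FF where "FF \<equiv> (FunField a :: (('v, 'k) mpoly set \<times> ('v, 'k) mpoly set) set ring)"

abbreviation hp where "hp \<equiv> (hpairs a :: (('v, 'k) mpoly set \<times> ('v, 'k) mpoly set) set)"

lemma hpairs_iff: "(f, g) \<in> hp \<longleftrightarrow> f \<in> carrier BR \<and> g \<in> carrier BR \<and> \<Psi> g \<noteq> 0 \<and> (\<exists>d. \<Psi> f \<in> FG d \<and> \<Psi> g \<in> FG d)"
  unfolding hpairs_def using \<Psi>_eq_0_iff Bdeg_iff by auto

definition quot where "quot p = \<Psi> (fst p) / \<Psi> (snd p)"

text \<open>Equality by cross multiplication is equality of quotients in the field, so the classes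
  are the fibres of \<open>quot\<close>.\<close>

lemma fcls_eq:
  assumes "p \<in> hp"
  shows "fcls a p = {q \<in> hp. quot q = quot p}"
proof -
  obtain f g where p: "p = (f, g)" by (cases p)
  have "f \<otimes>\<^bsub>BR\<^esub> g' = f' \<otimes>\<^bsub>BR\<^esub> g \<longleftrightarrow> quot (f', g') = quot (f, g)" if "(f', g') \<in> hp" for f' g'
  proof -
    have "f \<otimes>\<^bsub>BR\<^esub> g' = f' \<otimes>\<^bsub>BR\<^esub> g \<longleftrightarrow> \<Psi> f * \<Psi> g' = \<Psi> f' * \<Psi> g"
      using \<Psi>_eq_iff[OF BS_closed(1) BS_closed(1)] by (simp add: \<Psi>_hom)
    moreover have "\<Psi> g \<noteq> 0" "\<Psi> g' \<noteq> 0" using assms that p hpairs_iff by auto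
    ultimately show ?thesis by (auto simp: quot_def field_simps)
  qed
  then show ?thesis unfolding fcls_def p by auto
qed

definition \<Phi> where "\<Phi> F = quot (frep F)"

lemma frep_fcls:
  assumes "p \<in> hp"
  shows "frep (fcls a p) \<in> hp" "\<Phi> (fcls a p) = quot p"
proof -
  have "p \<in> fcls a p" using assms fcls_eq by simp
  then have "frep (fcls a p) \<in> fcls a p" unfolding frep_def by (rule someI)
  then show "frep (fcls a p) \<in> hp" "\<Phi> (fcls a p) = quot p"
    using fcls_eq[OF assms] by (auto simp: \<Phi>_def)
qed

lemma carrier_FF: "carrier FF = fcls a ` hp"
  by (simp add: FunField_def)

lemma FF_E:
  assumes "F \<in> carrier FF"
  obtains f g d where "frep F = (f, g)" "f \<in> carrier BR" "g \<in> carrier BR" "\<Psi> g \<noteq> 0" "\<Psi> f \<in> FG d" "\<Psi> g \<in> FG d" "\<Phi> F = \<Psi> f / \<Psi> g"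
proof -
  have "frep F \<in> hp" using assms frep_fcls(1) by (auto simp: carrier_FF)
  then show ?thesis using that by (cases "frep F") (auto simp: hpairs_iff \<Phi>_def quot_def)
qed

lemma FF_I:
  assumes "f \<in> carrier BR" "g \<in> carrier BR" "\<Psi> g \<noteq> 0" "\<Psi> f \<in> FG d" "\<Psi> g \<in> FG d"
  shows "fcls a (f, g) \<in> carrier FF \<and> \<Phi> (fcls a (f, g)) = \<Psi> f / \<Psi> g"
proof -
  have "(f, g) \<in> hp" using assms hpairs_iff by blast
  then show ?thesis using frep_fcls(2)[of "(f, g)"] by (simp add: carrier_FF quot_def)
qed

lemma FF_inj: "inj_on \<Phi> (carrier FF)"
proof (rule inj_onI)
  fix F F' assume "F \<in> carrier FF" "F' \<in> carrier FF" and e: "\<Phi> F = \<Phi> F'"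
  then obtain p q where "p \<in> hp" "q \<in> hp" "F = fcls a p" "F' = fcls a q" by (auto simp: carrier_FF)
  then show "F = F'" using e frep_fcls(2) fcls_eq by simp
qed

lemma FF_image: "\<Phi> ` carrier FF = hfrac"
proof
  show "\<Phi> ` carrier FF \<subseteq> hfrac"
  proof
    fix z assume "z \<in> \<Phi> ` carrier FF"
    then obtain F where F: "F \<in> carrier FF" "z = \<Phi> F" by blast
    show "z \<in> hfrac" by (rule FF_E[OF F(1)]) (simp add: F(2) hfracI)
  qed
  show "hfrac \<subseteq> \<Phi> ` carrier FF"
  proof
    fix z assume "z \<in> hfrac"
    then obtain u v d where z: "z = u / v" "u \<in> FG d" "v \<in> FG d" "v \<noteq> 0" unfolding hfrac_def by blast
    obtain f g where "f \<in> carrier BR" "u = \<Psi> f" "g \<in> carrier BR" "v = \<Psi> g"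
      using FB_E[OF G_B[OF z(2)]] FB_E[OF G_B[OF z(3)]] by metis
    then show "z \<in> \<Phi> ` carrier FF" using FF_I[of f g d] z by (metis imageI)
  qed
qed

lemma FF_mult:
  assumes "F \<in> carrier FF" "F' \<in> carrier FF"
  shows "F \<otimes>\<^bsub>FF\<^esub> F' \<in> carrier FF \<and> \<Phi> (F \<otimes>\<^bsub>FF\<^esub> F') = \<Phi> F * \<Phi> F'"
proof -
  obtain f g d where 1: "frep F = (f, g)" "\<Psi> g \<noteq> 0" "\<Psi> f \<in> FG d" "\<Psi> g \<in> FG d" "\<Phi> F = \<Psi> f / \<Psi> g"
    using FF_E[OF assms(1)] by metis
  obtain f' g' d' where 2: "frep F' = (f', g')" "\<Psi> g' \<noteq> 0" "\<Psi> f' \<in> FG d'" "\<Psi> g' \<in> FG d'" "\<Phi> F' = \<Psi> f' / \<Psi> g'"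
    using FF_E[OF assms(2)] by metis
  have "F \<otimes>\<^bsub>FF\<^esub> F' = fcls a (f \<otimes>\<^bsub>BR\<^esub> f', g \<otimes>\<^bsub>BR\<^esub> g')"
    by (simp add: FunField_def 1 2)
  then show ?thesis
    using FF_I[of "f \<otimes>\<^bsub>BR\<^esub> f'" "g \<otimes>\<^bsub>BR\<^esub> g'" "d + d'"] 1 2 by (simp add: BS_closed \<Psi>_hom G_mult)
qed

lemma FF_add:
  assumes "F \<in> carrier FF" "F' \<in> carrier FF"
  shows "F \<oplus>\<^bsub>FF\<^esub> F' \<in> carrier FF \<and> \<Phi> (F \<oplus>\<^bsub>FF\<^esub> F') = \<Phi> F + \<Phi> F'"
proof -
  obtain f g d where 1: "frep F = (f, g)" "\<Psi> g \<noteq> 0" "\<Psi> f \<in> FG d" "\<Psi> g \<in> FG d" "\<Phi> F = \<Psi> f / \<Psi> g"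
    using FF_E[OF assms(1)] by metis
  obtain f' g' d' where 2: "frep F' = (f', g')" "\<Psi> g' \<noteq> 0" "\<Psi> f' \<in> FG d'" "\<Psi> g' \<in> FG d'" "\<Phi> F' = \<Psi> f' / \<Psi> g'"
    using FF_E[OF assms(2)] by metis
  have e: "F \<oplus>\<^bsub>FF\<^esub> F' = fcls a ((f \<otimes>\<^bsub>BR\<^esub> g') \<oplus>\<^bsub>BR\<^esub> (f' \<otimes>\<^bsub>BR\<^esub> g), g \<otimes>\<^bsub>BR\<^esub> g')"
    by (simp add: FunField_def 1 2)
  have "\<Psi> f * \<Psi> g' + \<Psi> f' * \<Psi> g \<in> FG (d + d')"
    using G_add[OF G_mult[OF 1(3) 2(4)], of "\<Psi> f' * \<Psi> g"] G_mult[OF 2(3) 1(4)] by (simp add: add.commute)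
  then show ?thesis unfolding e
    using FF_I[of "(f \<otimes>\<^bsub>BR\<^esub> g') \<oplus>\<^bsub>BR\<^esub> (f' \<otimes>\<^bsub>BR\<^esub> g)" "g \<otimes>\<^bsub>BR\<^esub> g'" "d + d'"] 1 2
    by (simp add: BS_closed \<Psi>_hom G_mult add_frac_eq)
qed

lemma FF_one: "\<one>\<^bsub>FF\<^esub> \<in> carrier FF \<and> \<Phi> \<one>\<^bsub>FF\<^esub> = 1"
  using FF_I[of "\<one>\<^bsub>BR\<^esub>" "\<one>\<^bsub>BR\<^esub>" 0] by (simp add: FunField_def BS_closed \<Psi>_hom G_1)

lemma FF_zero: "\<zero>\<^bsub>FF\<^esub> \<in> carrier FF \<and> \<Phi> \<zero>\<^bsub>FF\<^esub> = 0"
  using FF_I[of "\<zero>\<^bsub>BR\<^esub>" "\<one>\<^bsub>BR\<^esub>" 0] by (simp add: FunField_def BS_closed \<Psi>_hom G_1 G_0)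

lemma FF_const: "fcls a (bscal a u, \<one>\<^bsub>BR\<^esub>) \<in> carrier FF \<and> \<Phi> (fcls a (bscal a u, \<one>\<^bsub>BR\<^esub>)) = c u"
  using FF_I[of "bscal a u" "\<one>\<^bsub>BR\<^esub>" 0] by (simp add: BS_closed \<Psi>_hom G_1 c_FG)

lemma field_embedding_FF: "field_embedding FF \<Phi>"
proof
  show "- \<Phi> F \<in> \<Phi> ` carrier FF" if "F \<in> carrier FF" for F
  proof -
    have "\<Phi> F \<in> hfrac" using that FF_image by blast
    then obtain u v d where "\<Phi> F = u / v" "u \<in> FG d" "v \<in> FG d" "v \<noteq> 0" unfolding hfrac_def by blast
    then show ?thesis unfolding FF_image using hfracI[of "- u" d v] G_uminus by simp
  qed
  show "inverse (\<Phi> F) \<in> \<Phi> ` carrier FF" if "F \<in> carrier FF" "\<Phi> F \<noteq> 0" for F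
  proof -
    have "\<Phi> F \<in> hfrac" using that FF_image by blast
    then obtain u v d where "\<Phi> F = u / v" "u \<in> FG d" "v \<in> FG d" "v \<noteq> 0" unfolding hfrac_def by blast
    then show ?thesis unfolding FF_image using hfracI[of v d u] that(2) by auto
  qed
qed (use FF_mult FF_add FF_one FF_zero FF_inj in auto)

text \<open>The kernel's degrees generate all integers, so a nonzero \<open>\<theta>\<close> of
  degree \<open>- ds\<close> exists and \<open>s * \<theta>\<close> has degree 0. The assumption
  \<open>c0\<close> puts the constants into \<open>kfrac 0\<close>.\<close>

lemma homogeneous_slice_ruled:
  assumes "homogeneous_slice FB FG D s e ds" "cotype a = 0" and c0: "\<And>u. D (c u) = 0"
  shows "Proj_ruled a TYPE('k)"
proof -
  interpret homogeneous_slice FB FG D s e ds by fact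
  interpret F: field_embedding FF \<Phi> by (rule field_embedding_FF)
  have deg: "d \<in> zspan kdegs" for d using zspan_kdegs[OF assms(1,2)] by simp
  obtain \<theta> where \<theta>: "\<theta> \<in> kfrac (- ds)" "\<theta> \<noteq> 0" using kfrac_nonzero[OF deg] by blast
  have "ruled_ext FF (kimage a TYPE('k))"
  proof (rule F.ruled_extI[where K = "kfrac 0" and t = "s * \<theta>"])
    show "kfrac 0 \<subseteq> \<Phi> ` carrier FF" unfolding FF_image using kfrac_0_hfrac by blast
    show "z + w \<in> kfrac 0" if "z \<in> kfrac 0" "w \<in> kfrac 0" for z w using kfrac_add that .
    show "z * w \<in> kfrac 0" if "z \<in> kfrac 0" "w \<in> kfrac 0" for z w using kfrac_mult[of z 0 w 0] that by simp
    show "- z \<in> kfrac 0" if "z \<in> kfrac 0" for z using kfrac_uminus that .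
    show "inverse z \<in> kfrac 0" if "z \<in> kfrac 0" for z using kfrac_inverse[of z 0] that by simp
    show "kimage a TYPE('k) \<subseteq> carrier FF" unfolding kimage_def using FF_const by blast
    have "c u \<in> kfrac 0" for u
      using c0 G_B[OF c_FG] by (intro kfrac_A c_FG) (simp add: A_def)
    then show "\<Phi> ` kimage a TYPE('k) \<subseteq> kfrac 0" unfolding kimage_def using FF_const by auto
    show "s * \<theta> \<in> \<Phi> ` carrier FF" unfolding FF_image by (rule t_in_hfrac[OF \<theta>(1)])
    show "P = 0" if "\<And>j. Polynomial.coeff P j \<in> kfrac 0" "poly P (s * \<theta>) = 0" for P
      using t_transcendental[OF \<theta> that] .
  qed (use kfrac_0 kfrac_1 hfrac_generated[OF \<theta> deg] in \<open>auto simp: FF_image\<close>)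
  then show ?thesis by (simp add: Proj_ruled_def)
qed

text \<open>\<open>e\<close> is the largest degree shift on a variable. Degrees add up in the
  Leibniz rule, so the bound passes to monomials and then to all homogeneous elements.\<close>

lemma leading_degree_exists:
  assumes "lnd FB FG D" and c0: "\<And>u. D (c u) = 0" and nz: "D (x i) \<noteq> 0"
  shows "\<exists>e i. filtered_lnd FB FG \<Lambda> D e \<and> pr (int (wt i) + e) (D (x i)) \<noteq> 0"
proof -
  interpret lnd FB FG D by fact
  have DxB: "D (x i) \<in> FB" for i using D_B G_B[OF x_FG] by blast
  \<comment> \<open>The degree shifts that occur on variables: finitely many, since each
    \<open>D (x i)\<close> has finitely many components, and at least one by
    \<open>nz\<close>.\<close>
  define E where "E = {j - int (wt i) | i j. pr j (D (x i)) \<noteq> 0}"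
  have "E \<subseteq> (\<Union>i. (\<lambda>n. int n - int (wt i)) ` {..Polynomial.degree (\<Lambda> (D (x i)))})"
  proof
    fix z assume "z \<in> E"
    then obtain i j where z: "z = j - int (wt i)" "pr j (D (x i)) \<noteq> 0" unfolding E_def by blast
    then have "0 \<le> j" "nat j \<le> Polynomial.degree (\<Lambda> (D (x i)))"
      by (auto simp: pr_def le_degree split: if_splits)
    then show "z \<in> (\<Union>i. (\<lambda>n. int n - int (wt i)) ` {..Polynomial.degree (\<Lambda> (D (x i)))})"
      using z(1) by (intro UN_I[of i] image_eqI[of _ _ "nat j"]) auto
  qed
  then have fin: "finite E" by (rule finite_subset) auto
  have "\<exists>n. pr (int n) (D (x i)) \<noteq> 0"
    using sum_pr[OF DxB[of i] order_refl] nz by (metis sum.neutral)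
  then have "E \<noteq> {}" unfolding E_def by blast
  define e where "e = Max E"
  have "e \<in> E" unfolding e_def using fin \<open>E \<noteq> {}\<close> by simp
  then obtain i0 j0 where "e = j0 - int (wt i0)" "pr j0 (D (x i0)) \<noteq> 0" unfolding E_def by blast
  then have i0: "pr (int (wt i0) + e) (D (x i0)) \<noteq> 0" by simp
  have bx: "bounded_by (int (wt i) + e) (D (x i))" for i
    unfolding bounded_by_def
  proof (intro allI impI, rule ccontr)
    fix j assume j: "j > int (wt i) + e" and "pr j (D (x i)) \<noteq> 0"
    then have "j - int (wt i) \<in> E" unfolding E_def by blast
    then have "j - int (wt i) \<le> e" unfolding e_def using fin by simp
    then show False using j by simp
  qed
  define good where "good d y \<longleftrightarrow> y \<in> FG d \<and> bounded_by (d + e) (D y)" for d y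
  have mult: "good (d + d') (y * z)" if y: "good d y" and z: "good d' z" for d d' y z
  proof -
    have B: "y \<in> FB" "z \<in> FB" using y z G_B by (auto simp: good_def)
    have "bounded_by (d + (d' + e)) (y * D z)" "bounded_by (d' + (d + e)) (z * D y)"
      using y z B by (auto simp: good_def intro!: bounded_by_mult_G D_B)
    then have "bounded_by (d + d' + e) (y * D z + D y * z)"
      using B by (intro bounded_by_add B_mult D_B) (simp_all add: ac_simps)
    then show ?thesis using y z B by (simp add: good_def G_mult D_mult)
  qed
  have one: "good 0 1" by (simp add: good_def G_1 bounded_by_0)
  have pow: "good (int n * d) (y ^ n)" if "good d y" for n d y
  proof (induction n)
    case (Suc n)
    then show ?case using mult[OF that Suc] by (simp add: algebra_simps)
  qed (simp add: one)
  have prod: "good (\<Sum>i\<in>I. d i) (\<Prod>i\<in>I. y i)" if "\<And>i. good (d i) (y i)" for I :: "'v set" and d y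
    by (induction I rule: infinite_finite_induct) (auto simp: one intro: mult that)
  have single: "good (int (monodeg a m)) (\<psi> (Poly_Mapping.single m u))" for m u
  proof -
    have "good (\<Sum>i\<in>UNIV. int (Poly_Mapping.lookup m i) * int (wt i)) (\<Prod>i\<in>UNIV. x i ^ Poly_Mapping.lookup m i)"
      by (intro prod pow) (simp add: good_def x_FG bx)
    moreover have "good 0 (c u)" by (simp add: good_def c_FG c0 bounded_by_0)
    ultimately show ?thesis
      using mult[of 0 "c u"] by (simp add: mev_single monodeg_def)
  qed
  have "bounded_by (d + e) (D y)" if "y \<in> FG d" for y d
  proof (cases "y = 0")
    case False
    from that False obtain p where p: "y = \<psi> p" "d \<ge> 0" "homog a (nat d) p" unfolding FG_def by auto
    have B: "\<psi> (Poly_Mapping.single m u) \<in> FB" for m u by (auto simp: FB_def)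
    have y: "y = (\<Sum>m\<in>Poly_Mapping.keys p. \<psi> (Poly_Mapping.single m (Poly_Mapping.lookup p m)))"
      unfolding p(1) by (rule \<psi>_expand)
    show ?thesis unfolding y D_sum[OF B]
    proof (rule bounded_by_sum)
      fix m assume "m \<in> Poly_Mapping.keys p"
      then have "int (monodeg a m) = d" using p by (simp add: homog_def)
      then show "bounded_by (d + e) (D (\<psi> (Poly_Mapping.single m (Poly_Mapping.lookup p m))))"
        using single[of m] by (auto simp: good_def)
    qed (intro D_B B)
  qed (simp add: bounded_by_0)
  then have "filtered_lnd FB FG \<Lambda> D e" by unfold_locales
  then show ?thesis using i0 by blast
qed

lemma not_rigid_ruled:
  assumes "\<not> rigid a TYPE('k)" "cotype a = 0"
  shows "Proj_ruled a TYPE('k)"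
proof -
  obtain D :: "('v, 'k) mpoly set \<Rightarrow> ('v, 'k) mpoly set" and Z
    where D: "is_LND a D" and Z: "Z \<in> carrier BR" "D Z \<noteq> \<zero>\<^bsub>BR\<^esub>"
    using assms(1) unfolding rigid_def by blast
  have DZ: "D Z \<in> carrier BR" using D Z(1) by (auto simp: is_LND_def is_kder_def)
  have lnd: "lnd FB FG (transport D)" by (rule lnd_transport[OF D])
  have c0: "transport D (c u) = 0" for u by (rule transport_c[OF D])
  have "transport D (\<Psi> Z) \<noteq> 0" using Z \<Psi>_eq_0_iff[OF DZ] by (simp add: transport_\<Psi>)
  then obtain i where "transport D (x i) \<noteq> 0"
    using lnd_eq_0[OF lnd c0 _ \<Psi>_FB[OF Z(1)]] by blast
  then obtain e j where fl: "filtered_lnd FB FG \<Lambda> (transport D) e"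
    and j: "pr (int (wt j) + e) (transport D (x j)) \<noteq> 0"
    using leading_degree_exists[OF lnd c0] by blast
  interpret T: filtered_lnd FB FG \<Lambda> "transport D" e by fact
  \<comment> \<open>The maximal shift is attained at \<open>x j\<close>, so the leading component is
    nonzero there and has a slice.\<close>
  have "T.Dtop (x j) \<noteq> 0" using T.Dtop_homogeneous[OF x_FG] j by simp
  then obtain s ds where "homogeneous_slice FB FG T.Dtop s e ds"
    using slice_exists[OF T.lnd_Dtop T.Dtop_G] by blast
  moreover have "T.Dtop (c u) = 0" for u
    using T.Dtop_homogeneous[OF c_FG, of u] c0 by simp
  ultimately show ?thesis using homogeneous_slice_ruled assms(2) by blast
qed

end

theorem theorem4p4:
  fixes a :: "'v::finite \<Rightarrow> nat"
  assumes "card (UNIV :: 'v set) \<ge> 4"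
    and "\<forall>i. a i > 0"
    and "cotype a = 0"
  shows "(\<forall>D \<in> (HLND a :: (('v, 'k::field_char_0) mpoly set \<Rightarrow> ('v, 'k) mpoly set) set).
            Zgrp a (derker a D) = UNIV)
         \<and> (\<not> rigid a TYPE('k) \<longrightarrow> Proj_ruled a TYPE('k))"
proof -
  have card: "card (UNIV :: 'v set) \<ge> 3" and pos: "\<And>i. a i > 0" using assms by auto
  obtain c :: "'k \<Rightarrow> 'k gfield fls" and x where "coeff_hom c" "\<And>p. mev c x p = 0 \<longleftrightarrow> fermat a dvd p"
    using fermat_generic_point[where a = a, OF card pos] by blast
  then interpret fermat_point c a x
    using card pos by (intro fermat_point.intro fermat_point_axioms.intro)
  show ?thesis using Zgrp_derker not_rigid_ruled assms(3) by blast
qed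

end
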